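(* For all integers $n\ge0$, $$b(6n+3)\equiv 0\pmod 6,\qquad b(36n+22)\equiv 0\pmod{36},\qquad b(12n+9)\equiv 0\pmod{54}.$$
   Context: The mock theta function $\mathcal{B}(q)=\sum_{n\ge0}\frac{q^n(-q;q^2)_n}{(q;q^2)_{n+1}}=\sum_{n\ge0}b(n)q^n$, where $(a;q)_n=\prod_{j=0}^{n-1}(1-aq^j)$. *)

theory Defs
  imports "HOL-Computational_Algebra.Formal_Power_Series"
begin

definition qpoch :: "rat fps \<Rightarrow> rat fps \<Rightarrow> nat \<Rightarrow> rat fps" where
  "qpoch a q n = (\<Prod>j<n. 1 - a * q ^ j)"

text \<open>The n-th summand q^n (-q;q^2)_n / (q;q^2)_{n+1}; it is divisible by q^n,
  so the coefficient of q^m of the full series is the coefficient of the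
  finite partial sum over n \<le> m.\<close>
definition Bterm :: "nat \<Rightarrow> rat fps" where
  "Bterm n = fps_X ^ n * qpoch (- fps_X) (fps_X ^ 2) n
             * inverse (qpoch fps_X (fps_X ^ 2) (Suc n))"

definition b :: "nat \<Rightarrow> rat" where
  "b m = fps_nth (\<Sum>n\<le>m. Bterm n) m"

end

(*
  Comparing coefficients along the diagonals of the expansion of B in q-Delannoy numbers shows
  that phi(-q^2) B(q), where phi(-q) is the alternating sum of q^(n^2), is the Lerch sum of
  (-1)^k q^(2k^2 + 2k) / (1 - q^(2k+1)). With theta_r the alternating sum of q^(3n^2 + rn), one has
  phi(-q^2) = theta_0(q^6) - 2 q^2 theta_2(q^6), so multiplying by the complementary quadratic factor
  reduces the dissection of B modulo 6 to Lerch sums to the base q^6. In the classes 3 and 4 these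
  combine into theta functions: two Lerch sums with the same ratio of numerator to denominator
  variable, each multiplied by the theta function of the other, differ by a theta function times a
  Kronecker sum. With D = theta_0^3 - 8 q theta_2^3 and the even series kappa = theta_2 C, for a
  certain integral series C, this gives
    D * (sum of b(6n+3) q^n) = 6 theta_1^2 C,   D * (sum of b(6n+4) q^n) = 9 theta_0 kappa.
  Finally theta_2 D = theta_1^4 - 9 q theta_2^4, where theta_1 is even, and theta_0^2 is 1 modulo 4, so
  modulo 9 and modulo 4 the two quotients are even series.
*)

theory Submission
  imports Defs
begin

section \<open>Sums of locally finite families of power series\<close>

text \<open>The series C is \<open>L 3 1\<close>, the sum over all integers k of (-1)^k q^(3k^2 +
  3k) / (1 - q^(6k+1)). Both C and D have terms of either parity, so neither quotient is visibly
  even to any modulus. The evenness of kappa comes from a second form of it: theta_1 times the Lerch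
  sum with denominators 1 - q^(6k+2), where every exponent is even. For the modulus 9, theta_0 is
  eliminated from D by a quartic relation between the three theta functions; for the modulus 4, the
  term 8 q theta_2^3 drops out. No infinite product is used. All relations between theta and Lerch
  sums, the quartic one included, come from one exchange relation, whose proof consists of three
  changes of summation index and one identity of signs. Power series in one variable leave no room
  for negative exponents, so the variables are powers of q from the start, and spare powers of q are
  carried through the equations to keep every exponent nonnegative. Theta functions may be cancelled
  because their constant coefficient is 1.\<close>

definition loc_finite :: "('i \<Rightarrow> 'a::comm_ring_1 fps) \<Rightarrow> bool" where
  "loc_finite g \<longleftrightarrow> (\<forall>n. finite {i. fps_nth (g i) n \<noteq> 0})"

text \<open>By the convention for \<open>sum\<close>, an infinite support gives the coefficient 0.
  The laws for addition, products and splitting therefore assume \<open>loc_finite\<close>, while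
  reindexing along a bijection is unconditional.\<close>

definition fsum :: "('i \<Rightarrow> 'a::comm_ring_1 fps) \<Rightarrow> 'a fps" where
  "fsum g = Abs_fps (\<lambda>n. \<Sum>i | fps_nth (g i) n \<noteq> 0. fps_nth (g i) n)"

lemma fsum_nth: "fps_nth (fsum g) n = (\<Sum>i | fps_nth (g i) n \<noteq> 0. fps_nth (g i) n)"
  by (simp add: fsum_def)

lemma fsum_nth_eq:
  assumes "finite S" "\<And>i. fps_nth (g i) n \<noteq> 0 \<Longrightarrow> i \<in> S"
  shows "fps_nth (fsum g) n = (\<Sum>i\<in>S. fps_nth (g i) n)"
  unfolding fsum_nth using assms by (intro sum.mono_neutral_left) auto

lemma loc_finiteD: "loc_finite g \<Longrightarrow> finite {i. fps_nth (g i) n \<noteq> 0}"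
  by (simp add: loc_finite_def)

lemma loc_finite_add: assumes "loc_finite f" "loc_finite g" shows "loc_finite (\<lambda>i. f i + g i)"
  unfolding loc_finite_def
proof
  fix n
  show "finite {i. fps_nth (f i + g i) n \<noteq> 0}"
    by (rule finite_subset[OF _ finite_UnI[OF loc_finiteD[OF assms(1), of n] loc_finiteD[OF assms(2), of n]]]) auto
qed

lemma fsum_add: assumes "loc_finite f" "loc_finite g" shows "fsum (\<lambda>i. f i + g i) = fsum f + fsum g"
proof (rule fps_ext)
  fix n
  let ?S = "{i. fps_nth (f i) n \<noteq> 0} \<union> {i. fps_nth (g i) n \<noteq> 0}"
  have S: "finite ?S" using assms by (simp add: loc_finiteD)
  have "fps_nth (fsum (\<lambda>i. f i + g i)) n = (\<Sum>i\<in>?S. fps_nth (f i + g i) n)"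
    by (rule fsum_nth_eq[OF S]) auto
  also have "\<dots> = (\<Sum>i\<in>?S. fps_nth (f i) n) + (\<Sum>i\<in>?S. fps_nth (g i) n)"
    by (simp add: sum.distrib)
  also have "(\<Sum>i\<in>?S. fps_nth (f i) n) = fps_nth (fsum f) n"
    by (rule fsum_nth_eq[OF S, symmetric]) auto
  also have "(\<Sum>i\<in>?S. fps_nth (g i) n) = fps_nth (fsum g) n"
    by (rule fsum_nth_eq[OF S, symmetric]) auto
  finally show "fps_nth (fsum (\<lambda>i. f i + g i)) n = fps_nth (fsum f + fsum g) n" by simp
qed

lemma mult_nth_nonzeroE:
  assumes "fps_nth (f * g :: 'a::comm_ring_1 fps) n \<noteq> 0"
  obtains k where "k \<le> n" "fps_nth f k \<noteq> 0" "fps_nth g (n - k) \<noteq> 0"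
proof -
  from assms have "(\<Sum>j=0..n. fps_nth f j * fps_nth g (n - j)) \<noteq> 0" by (simp add: fps_mult_nth)
  then obtain j where "j \<in> {0..n}" "fps_nth f j * fps_nth g (n - j) \<noteq> 0"
    by (rule sum.not_neutral_contains_not_neutral)
  then have "j \<le> n" "fps_nth f j \<noteq> 0" "fps_nth g (n - j) \<noteq> 0" by auto
  then show ?thesis by (rule that)
qed

lemma fsum_nth_nonzeroE:
  assumes "fps_nth (fsum g) n \<noteq> 0"
  obtains i where "fps_nth (g i) n \<noteq> 0"
  using assms unfolding fsum_nth by (rule sum.not_neutral_contains_not_neutral)

lemma loc_finite_cmult: assumes "loc_finite g" shows "loc_finite (\<lambda>i. c * g i)"
  unfolding loc_finite_def
proof
  fix n
  have "{i. fps_nth (c * g i) n \<noteq> 0} \<subseteq> (\<Union>j\<le>n. {i. fps_nth (g i) j \<noteq> 0})"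
    by (auto elim!: mult_nth_nonzeroE intro!: diff_le_self)
  then show "finite {i. fps_nth (c * g i) n \<noteq> 0}"
    by (rule finite_subset) (auto intro: loc_finiteD[OF assms])
qed

lemma fsum_cmult: assumes "loc_finite g" shows "fsum (\<lambda>i. c * g i) = c * fsum g"
proof (rule fps_ext)
  fix n
  let ?S = "\<Union>j\<le>n. {i. fps_nth (g i) j \<noteq> 0}"
  have S: "finite ?S" by (auto intro: loc_finiteD[OF assms])
  have "fps_nth (fsum (\<lambda>i. c * g i)) n = (\<Sum>i\<in>?S. fps_nth (c * g i) n)"
    by (rule fsum_nth_eq[OF S]) (auto elim!: mult_nth_nonzeroE intro!: diff_le_self)
  also have "\<dots> = (\<Sum>j=0..n. fps_nth c j * (\<Sum>i\<in>?S. fps_nth (g i) (n - j)))"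
    by (simp add: fps_mult_nth sum_distrib_left sum.swap[of _ _ ?S])
  also have "\<dots> = (\<Sum>j=0..n. fps_nth c j * fps_nth (fsum g) (n - j))"
    by (intro sum.cong refl arg_cong2[where f = "(*)"] fsum_nth_eq[OF S, symmetric]) auto
  finally show "fps_nth (fsum (\<lambda>i. c * g i)) n = fps_nth (c * fsum g) n"
    by (simp add: fps_mult_nth)
qed

lemma fsum_mult_right: "loc_finite g \<Longrightarrow> fsum (\<lambda>i. g i * c) = fsum g * c"
  using fsum_cmult[of g c] by (simp add: mult.commute)

lemma loc_finite_uminus: "loc_finite g \<Longrightarrow> loc_finite (\<lambda>i. - g i)"
  using loc_finite_cmult[of g "-1"] by simp

lemma fsum_diff: assumes "loc_finite f" "loc_finite g" shows "fsum (\<lambda>i. f i - g i) = fsum f - fsum g"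
  using fsum_add[OF assms(1) loc_finite_uminus[OF assms(2)]] fsum_cmult[OF assms(2), of "-1"] by simp

lemma loc_finite_inj: assumes "loc_finite g" "inj h" shows "loc_finite (\<lambda>i. g (h i))"
  unfolding loc_finite_def
proof
  fix n
  show "finite {i. fps_nth (g (h i)) n \<noteq> 0}"
    using finite_vimageI[OF loc_finiteD[OF assms(1), of n] assms(2)] by (simp add: vimage_def)
qed

lemma fsum_inj:
  assumes "inj h" "\<And>j. j \<notin> range h \<Longrightarrow> g j = 0"
  shows "fsum (\<lambda>i. g (h i)) = fsum g"
proof (rule fps_ext)
  fix n
  have "bij_betw h {i. fps_nth (g (h i)) n \<noteq> 0} {j. fps_nth (g j) n \<noteq> 0}"
  proof (rule bij_betw_imageI)
    show "inj_on h {i. fps_nth (g (h i)) n \<noteq> 0}" using assms(1) by (rule inj_on_subset) simp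
    show "h ` {i. fps_nth (g (h i)) n \<noteq> 0} = {j. fps_nth (g j) n \<noteq> 0}"
    proof (rule set_eqI)
      fix j
      show "j \<in> h ` {i. fps_nth (g (h i)) n \<noteq> 0} \<longleftrightarrow> j \<in> {j. fps_nth (g j) n \<noteq> 0}"
        using assms(2)[of j] by (cases "j \<in> range h") auto
    qed
  qed
  from sum.reindex_bij_betw[OF this, of "\<lambda>j. fps_nth (g j) n"]
  show "fps_nth (fsum (\<lambda>i. g (h i))) n = fps_nth (fsum g) n"
    by (simp add: fsum_nth)
qed

lemma fsum_bij: "bij h \<Longrightarrow> fsum (\<lambda>i. g (h i)) = fsum g"
  by (rule fsum_inj) (auto simp: bij_def)

lemma fsum_restrict_inj:
  assumes "inj h"
  shows "fsum (\<lambda>j. if j \<in> range h then g j else 0) = fsum (\<lambda>i. g (h i))"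
  using fsum_inj[OF assms, of "\<lambda>j. if j \<in> range h then g j else 0"] by simp

lemma loc_finite_restrict: assumes "loc_finite g" shows "loc_finite (\<lambda>j. if j \<in> A then g j else 0)"
  unfolding loc_finite_def
proof
  fix n
  show "finite {i. fps_nth (if i \<in> A then g i else 0) n \<noteq> 0}"
    by (rule finite_subset[OF _ loc_finiteD[OF assms, of n]]) auto
qed

lemma fsum_split2:
  assumes "loc_finite g" "inj h1" "inj h2" "range h1 \<inter> range h2 = {}"
    and "\<And>j. j \<notin> range h1 \<Longrightarrow> j \<notin> range h2 \<Longrightarrow> g j = 0"
  shows "fsum g = fsum (\<lambda>i. g (h1 i)) + fsum (\<lambda>i. g (h2 i))"
proof -
  have "g = (\<lambda>j. (if j \<in> range h1 then g j else 0) + (if j \<in> range h2 then g j else 0))"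
  proof
    fix j show "g j = (if j \<in> range h1 then g j else 0) + (if j \<in> range h2 then g j else 0)"
      using assms(4) assms(5)[of j] by (cases "j \<in> range h1"; cases "j \<in> range h2") auto
  qed
  then have "fsum g = fsum (\<lambda>j. (if j \<in> range h1 then g j else 0) + (if j \<in> range h2 then g j else 0))"
    by (rule arg_cong)
  also have "\<dots> = fsum (\<lambda>i. g (h1 i)) + fsum (\<lambda>i. g (h2 i))"
    unfolding fsum_add[OF loc_finite_restrict[OF assms(1)] loc_finite_restrict[OF assms(1)]]
    by (simp only: fsum_restrict_inj[OF assms(2)] fsum_restrict_inj[OF assms(3)])
  finally show ?thesis .
qed

lemma fsum_split3:
  assumes "loc_finite g" "inj h1" "inj h2" "inj h3"
    and "range h1 \<inter> range h2 = {}" "range h1 \<inter> range h3 = {}" "range h2 \<inter> range h3 = {}"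
    and "\<And>j. j \<notin> range h1 \<Longrightarrow> j \<notin> range h2 \<Longrightarrow> j \<notin> range h3 \<Longrightarrow> g j = 0"
  shows "fsum g = fsum (\<lambda>i. g (h1 i)) + fsum (\<lambda>i. g (h2 i)) + fsum (\<lambda>i. g (h3 i))"
proof -
  have "g = (\<lambda>j. ((if j \<in> range h1 then g j else 0) + (if j \<in> range h2 then g j else 0))
    + (if j \<in> range h3 then g j else 0))"
  proof
    fix j show "g j = ((if j \<in> range h1 then g j else 0) + (if j \<in> range h2 then g j else 0))
      + (if j \<in> range h3 then g j else 0)"
      using assms(5-7) assms(8)[of j]
      by (cases "j \<in> range h1"; cases "j \<in> range h2"; cases "j \<in> range h3") auto
  qed
  then have "fsum g = fsum (\<lambda>j. ((if j \<in> range h1 then g j else 0) + (if j \<in> range h2 then g j else 0))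
    + (if j \<in> range h3 then g j else 0))"
    by (rule arg_cong)
  also have "\<dots> = fsum (\<lambda>i. g (h1 i)) + fsum (\<lambda>i. g (h2 i)) + fsum (\<lambda>i. g (h3 i))"
    unfolding fsum_add[OF loc_finite_add[OF loc_finite_restrict[OF assms(1)] loc_finite_restrict[OF assms(1)]] loc_finite_restrict[OF assms(1)]]
      fsum_add[OF loc_finite_restrict[OF assms(1)] loc_finite_restrict[OF assms(1)]]
    by (simp only: fsum_restrict_inj[OF assms(2)] fsum_restrict_inj[OF assms(3)]
        fsum_restrict_inj[OF assms(4)])
  finally show ?thesis .
qed

lemma fsum_nat_Suc:
  assumes "loc_finite g" shows "fsum g = g 0 + fsum (\<lambda>n. g (Suc n))"
proof (rule fps_ext)
  fix n
  define S where "S = {i. fps_nth (g (Suc i)) n \<noteq> 0}"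
  have "finite S" unfolding S_def by (rule loc_finiteD[OF loc_finite_inj[OF assms inj_Suc]])
  have "fps_nth (fsum g) n = (\<Sum>i\<in>insert 0 (Suc ` S). fps_nth (g i) n)"
  proof (rule fsum_nth_eq)
    fix i assume "fps_nth (g i) n \<noteq> 0"
    then show "i \<in> insert 0 (Suc ` S)" by (cases i) (auto simp: S_def)
  qed (use \<open>finite S\<close> in simp)
  also have "\<dots> = fps_nth (g 0) n + (\<Sum>i\<in>S. fps_nth (g (Suc i)) n)"
    using \<open>finite S\<close> by (subst sum.insert) (auto simp: sum.reindex)
  finally show "fps_nth (fsum g) n = fps_nth (g 0 + fsum (\<lambda>n. g (Suc n))) n"
    by (simp add: fsum_nth S_def)
qed

text \<open>The finitely many pairs that contribute to coefficient n lie in a finite rectangle;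
  there the sum can be iterated, and outside it the inner sums vanish at n.\<close>

lemma fsum_Pair: assumes "loc_finite g" shows "fsum g = fsum (\<lambda>i. fsum (\<lambda>j. g (i, j)))"
proof (rule fps_ext)
  fix n
  define S where "S = {p. fps_nth (g p) n \<noteq> 0}"
  have S: "finite S" unfolding S_def by (rule loc_finiteD[OF assms])
  have "fps_nth (fsum g) n = (\<Sum>p\<in>fst ` S \<times> snd ` S. fps_nth (g p) n)"
  proof (rule fsum_nth_eq)
    fix p assume "fps_nth (g p) n \<noteq> 0"
    then have "p \<in> S" by (simp add: S_def)
    then show "p \<in> fst ` S \<times> snd ` S" by (cases p) force
  qed (use S in simp)
  also have "\<dots> = (\<Sum>i\<in>fst ` S. \<Sum>j\<in>snd ` S. fps_nth (g (i, j)) n)"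
    by (simp add: sum.cartesian_product)
  also have "\<dots> = (\<Sum>i\<in>fst ` S. fps_nth (fsum (\<lambda>j. g (i, j))) n)"
  proof (rule sum.cong[OF refl], rule fsum_nth_eq[symmetric])
    fix i j assume "fps_nth (g (i, j)) n \<noteq> 0"
    then show "j \<in> snd ` S" by (force simp: S_def)
  qed (use S in simp)
  also have "\<dots> = fps_nth (fsum (\<lambda>i. fsum (\<lambda>j. g (i, j)))) n"
  proof (rule fsum_nth_eq[symmetric])
    fix i assume "fps_nth (fsum (\<lambda>j. g (i, j))) n \<noteq> 0"
    then show "i \<in> fst ` S" by (force simp: S_def elim!: fsum_nth_nonzeroE)
  qed (use S in simp)
  finally show "fps_nth (fsum g) n = fps_nth (fsum (\<lambda>i. fsum (\<lambda>j. g (i, j)))) n" .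
qed

lemma loc_finite_mult:
  assumes "loc_finite f" "loc_finite g" shows "loc_finite (\<lambda>(i, j). f i * g j)"
  unfolding loc_finite_def
proof
  fix n
  have "{p. fps_nth (case p of (i, j) \<Rightarrow> f i * g j) n \<noteq> 0}
      \<subseteq> (\<Union>k\<le>n. {i. fps_nth (f i) k \<noteq> 0} \<times> {j. fps_nth (g j) (n - k) \<noteq> 0})"
    by (auto elim!: mult_nth_nonzeroE)
  then show "finite {p. fps_nth (case p of (i, j) \<Rightarrow> f i * g j) n \<noteq> 0}"
    by (rule finite_subset) (auto intro: loc_finiteD assms)
qed

lemma fsum_mult:
  assumes "loc_finite f" "loc_finite g" shows "fsum f * fsum g = fsum (\<lambda>(i, j). f i * g j)"
  by (subst fsum_Pair[OF loc_finite_mult[OF assms]])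
    (simp add: fsum_cmult[OF assms(2)] fsum_mult_right[OF assms(1)])

section \<open>From the definition to a partial theta expansion\<close>

lemma loc_finite_natI:
  assumes "\<And>i. i \<le> e i" shows "loc_finite (\<lambda>i. fps_X ^ e i * h i)"
  unfolding loc_finite_def
proof
  fix n
  show "finite {i. fps_nth (fps_X ^ e i * h i) n \<noteq> 0}"
    by (rule finite_subset[of _ "{..n}"])
      (use assms in \<open>auto simp: fps_X_power_mult_nth not_less intro: order_trans split: if_splits\<close>)
qed

lemma loc_finite_nat_natI:
  assumes "\<And>i j. i \<le> e i j" "\<And>i j. j \<le> e i j"
  shows "loc_finite (\<lambda>(i, j). fps_X ^ e i j * h i j)"
  unfolding loc_finite_def
proof
  fix n
  show "finite {p. fps_nth (case p of (i, j) \<Rightarrow> fps_X ^ e i j * h i j) n \<noteq> 0}"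
    by (rule finite_subset[of _ "{..n} \<times> {..n}"])
      (auto simp: fps_X_power_mult_nth not_less intro: order_trans[OF assms(1)] order_trans[OF assms(2)]
        split: if_splits)
qed

text \<open>The coefficient of \<open>y\<^sup>k\<close> in \<open>(-y;q)\<^sub>n / (y;q)\<^sub>n\<^sub>+\<^sub>1\<close>, a \<open>q\<close>-analogue of the Delannoy numbers.\<close>

fun delannoy :: "'a::comm_ring_1 \<Rightarrow> nat \<Rightarrow> nat \<Rightarrow> 'a" where
  "delannoy q 0 k = 1"
| "delannoy q (Suc n) 0 = 1"
| "delannoy q (Suc n) (Suc k) = q ^ Suc n * delannoy q (Suc n) k + delannoy q n (Suc k) + q ^ n * delannoy q n k"

lemma delannoy_0_right [simp]: "delannoy q n 0 = 1"
  by (cases n) simp_all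

text \<open>This is the defining recursion with the two indices exchanged, which is what symmetry
  needs. The two recursions commute: expanding by one and then by the other gives the same nine
  terms in either order, and the induction on n + k regroups them.\<close>

lemma delannoy_rec2:
  "delannoy q (Suc n) (Suc k) = delannoy q (Suc n) k + q ^ Suc k * delannoy q n (Suc k) + q ^ k * delannoy q n k"
proof (induction "n + k" arbitrary: n k rule: less_induct)
  case less
  show ?case
  proof (cases n)
    case 0
    show ?thesis
    proof (cases k)
      case (Suc j)
      have "delannoy q (Suc 0) (Suc j) = delannoy q (Suc 0) j + q ^ Suc j + q ^ j"
        using less[of 0 j] Suc 0 by simp
      then show ?thesis unfolding 0 Suc delannoy.simps(3)[of q 0 "Suc j"]
        by (subst (2) delannoy.simps(3)) (simp add: algebra_simps)
    qed (simp add: 0)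
  next
    case (Suc m)
    show ?thesis
    proof (cases k)
      case 0
      have "delannoy q (Suc m) (Suc 0) = 1 + q * delannoy q m (Suc 0) + 1"
        using less[of m 0] Suc 0 by simp
      moreover have "delannoy q (Suc m) (Suc 0) = q ^ Suc m + delannoy q m (Suc 0) + q ^ m" by simp
      ultimately show ?thesis unfolding 0 Suc delannoy.simps(3)[of q "Suc m" 0]
        by (simp add: algebra_simps del: delannoy.simps(3))
          (metis (no_types, opaque_lifting) add.assoc add.commute distrib_left)
    next
      case (Suc j)
      have a: "delannoy q (Suc (Suc m)) (Suc j) = delannoy q (Suc (Suc m)) j + q ^ Suc j * delannoy q (Suc m) (Suc j)
          + q ^ j * delannoy q (Suc m) j"
        using less[of "Suc m" j] \<open>n = Suc m\<close> Suc by simp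
      have b: "delannoy q (Suc m) (Suc (Suc j)) = delannoy q (Suc m) (Suc j) + q ^ Suc (Suc j) * delannoy q m (Suc (Suc j))
          + q ^ Suc j * delannoy q m (Suc j)"
        using less[of m "Suc j"] \<open>n = Suc m\<close> Suc by simp
      have c: "delannoy q (Suc m) (Suc j) = delannoy q (Suc m) j + q ^ Suc j * delannoy q m (Suc j) + q ^ j * delannoy q m j"
        using less[of m j] \<open>n = Suc m\<close> Suc by simp
      have d: "delannoy q (Suc (Suc m)) (Suc j) = q ^ Suc (Suc m) * delannoy q (Suc (Suc m)) j + delannoy q (Suc m) (Suc j)
          + q ^ Suc m * delannoy q (Suc m) j"
        and e: "delannoy q (Suc m) (Suc (Suc j)) = q ^ Suc m * delannoy q (Suc m) (Suc j) + delannoy q m (Suc (Suc j))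
          + q ^ m * delannoy q m (Suc j)"
        and f: "delannoy q (Suc m) (Suc j) = q ^ Suc m * delannoy q (Suc m) j + delannoy q m (Suc j) + q ^ m * delannoy q m j"
        by simp_all
      have "delannoy q (Suc (Suc m)) (Suc (Suc j)) = q ^ Suc (Suc m) * delannoy q (Suc (Suc m)) (Suc j)
          + delannoy q (Suc m) (Suc (Suc j)) + q ^ Suc m * delannoy q (Suc m) (Suc j)"
        by simp
      also have "\<dots> = q ^ Suc (Suc m) * (delannoy q (Suc (Suc m)) j + q ^ Suc j * delannoy q (Suc m) (Suc j) + q ^ j * delannoy q (Suc m) j)
          + (delannoy q (Suc m) (Suc j) + q ^ Suc (Suc j) * delannoy q m (Suc (Suc j)) + q ^ Suc j * delannoy q m (Suc j))
          + q ^ Suc m * (delannoy q (Suc m) j + q ^ Suc j * delannoy q m (Suc j) + q ^ j * delannoy q m j)"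
        by (simp only: a b c[symmetric])
      also have "\<dots> = (q ^ Suc (Suc m) * delannoy q (Suc (Suc m)) j + delannoy q (Suc m) (Suc j) + q ^ Suc m * delannoy q (Suc m) j)
          + q ^ Suc (Suc j) * (q ^ Suc m * delannoy q (Suc m) (Suc j) + delannoy q m (Suc (Suc j)) + q ^ m * delannoy q m (Suc j))
          + q ^ Suc j * (q ^ Suc m * delannoy q (Suc m) j + delannoy q m (Suc j) + q ^ m * delannoy q m j)"
        by (simp add: algebra_simps del: delannoy.simps)
      finally have "delannoy q (Suc (Suc m)) (Suc (Suc j)) = delannoy q (Suc (Suc m)) (Suc j)
          + q ^ Suc (Suc j) * delannoy q (Suc m) (Suc (Suc j)) + q ^ Suc j * delannoy q (Suc m) (Suc j)"
        by (simp only: d[symmetric] e[symmetric] f[symmetric])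
      then show ?thesis by (simp only: \<open>n = Suc m\<close> Suc)
    qed
  qed
qed

lemma delannoy_sym: "delannoy q n k = delannoy q k n"
proof (induction "n + k" arbitrary: n k rule: less_induct)
  case less
  show ?case
  proof (cases n)
    case (Suc m)
    show ?thesis
    proof (cases k)
      case (Suc j)
      have "delannoy q (Suc m) (Suc j) = q ^ Suc m * delannoy q (Suc m) j + delannoy q m (Suc j) + q ^ m * delannoy q m j"
        by simp
      also have "\<dots> = q ^ Suc m * delannoy q j (Suc m) + delannoy q (Suc j) m + q ^ m * delannoy q j m"
        using less[of "Suc m" j] less[of m "Suc j"] less[of m j] \<open>n = Suc m\<close> Suc by simp
      also have "\<dots> = delannoy q (Suc j) (Suc m)"
        by (simp only: delannoy_rec2[of q j m] ac_simps)
      finally show ?thesis by (simp only: \<open>n = Suc m\<close> Suc)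
    qed simp
  qed simp
qed

section \<open>Generating function of the q-Delannoy numbers and B as a double sum\<close>

abbreviation Q :: "rat fps" where "Q \<equiv> fps_X ^ 2"

lemma Q_power: "Q ^ n = fps_X ^ (2 * n)"
  by (simp add: power_mult)

lemma qpoch_Suc: "qpoch a q (Suc n) = qpoch a q n * (1 - a * q ^ n)"
  by (simp add: qpoch_def)

text \<open>Summing the recursion against y^k shows that the step from n to n + 1 multiplies the
  generating function by (1 + y q^n) / (1 - y q^(n+1)); here y is \<open>fps_X\<close> and the base
  q is \<open>Q\<close>.\<close>

lemma fsum_X_delannoy:
  "fsum (\<lambda>k. fps_X ^ k * delannoy Q n k) * qpoch fps_X Q (Suc n) = qpoch (- fps_X) Q n"
proof (induction n)
  case 0
  have "fsum (\<lambda>k. fps_X ^ k * (1 :: rat fps)) = 1 + fps_X * fsum (\<lambda>k. fps_X ^ k * (1 :: rat fps))"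
    by (subst fsum_nat_Suc, rule loc_finite_natI, simp, subst fsum_cmult[symmetric], rule loc_finite_natI, simp)
      (simp add: mult.assoc)
  then show ?case by (simp add: qpoch_def algebra_simps)
next
  case (Suc n)
  let ?g = "\<lambda>n k. fps_X ^ k * delannoy Q n k"
  have loc_finite: "loc_finite (?g m)" for m by (rule loc_finite_natI) simp
  have loc_finite_S: "loc_finite (\<lambda>k. ?g m (Suc k))" for m by (rule loc_finite_inj[OF loc_finite]) simp
  have "fsum (?g (Suc n)) = 1 + fsum (\<lambda>k. ?g (Suc n) (Suc k))"
    by (subst fsum_nat_Suc[OF loc_finite]) simp
  also have "(\<lambda>k. ?g (Suc n) (Suc k)) =
      (\<lambda>k. (fps_X * Q ^ Suc n * ?g (Suc n) k + ?g n (Suc k)) + fps_X * Q ^ n * ?g n k)"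
    by (simp add: algebra_simps)
  also have "fsum \<dots> = fps_X * Q ^ Suc n * fsum (?g (Suc n)) + fsum (\<lambda>k. ?g n (Suc k)) + fps_X * Q ^ n * fsum (?g n)"
    by (simp only: fsum_add loc_finite_add loc_finite_cmult loc_finite loc_finite_S fsum_cmult)
  also have "fsum (\<lambda>k. ?g n (Suc k)) = fsum (?g n) - 1"
    using fsum_nat_Suc[OF loc_finite, of n] by simp
  finally have "fsum (?g (Suc n)) * (1 - fps_X * Q ^ Suc n) = fsum (?g n) * (1 - (- fps_X) * Q ^ n)"
    by (simp add: algebra_simps)
  then have "fsum (?g (Suc n)) * qpoch fps_X Q (Suc (Suc n))
      = (fsum (?g n) * qpoch fps_X Q (Suc n)) * (1 - (- fps_X) * Q ^ n)"
    unfolding qpoch_Suc[of _ _ "Suc n"] by (simp only: mult_ac)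
  then show ?case unfolding Suc.IH by (simp only: qpoch_Suc)
qed

lemma qpoch_X_nth_0: "fps_nth (qpoch fps_X Q n) 0 = 1"
  by (induction n) (simp_all add: qpoch_def)

lemma Bterm_eq_fsum: "Bterm n = fsum (\<lambda>k. fps_X ^ (n + k) * delannoy Q n k)"
proof -
  have "fsum (\<lambda>k. fps_X ^ (n + k) * delannoy Q n k) = fps_X ^ n * fsum (\<lambda>k. fps_X ^ k * delannoy Q n k)"
    by (simp add: fsum_cmult[OF loc_finite_natI, symmetric] power_add mult.assoc)
  also have "fsum (\<lambda>k. fps_X ^ k * delannoy Q n k) = qpoch (- fps_X) Q n * inverse (qpoch fps_X Q (Suc n))"
    unfolding fsum_X_delannoy[symmetric] mult.assoc
    by (subst inverse_mult_eq_1') (simp_all add: qpoch_X_nth_0)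
  finally show ?thesis by (simp add: Bterm_def mult.assoc)
qed

lemma loc_finite_X_delannoy: "loc_finite (\<lambda>(n, k). fps_X ^ (n + k) * delannoy Q n k)"
  by (rule loc_finite_nat_natI) simp_all

lemma Abs_fps_b: "Abs_fps b = fsum (\<lambda>(n, k). fps_X ^ (n + k) * delannoy Q n k)"
proof (rule fps_ext)
  fix m
  have "fps_nth (fsum Bterm) m = (\<Sum>n\<le>m. fps_nth (Bterm n) m)"
  proof (rule fsum_nth_eq)
    fix n assume "fps_nth (Bterm n) m \<noteq> 0"
    then show "n \<in> {..m}" by (auto simp: Bterm_def mult.assoc fps_X_power_mult_nth split: if_splits)
  qed simp
  moreover have "fsum Bterm = fsum (\<lambda>(n, k). fps_X ^ (n + k) * delannoy Q n k)"
    unfolding fsum_Pair[OF loc_finite_X_delannoy] Bterm_eq_fsum[abs_def] by simp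
  ultimately show "fps_nth (Abs_fps b) m = fps_nth (fsum (\<lambda>(n, k). fps_X ^ (n + k) * delannoy Q n k)) m"
    by (simp add: b_def fps_sum_nth)
qed

text \<open>On the diagonal (n, n + k) the monomial \<open>fps_X ^ (n + (n + k))\<close> is
  \<open>fps_X ^ k * Q ^ n\<close>, so s = 0 is the sum that occurs in B. The case s = 1 is
  auxiliary: it absorbs the extra power of the base that the recursions put in front of some
  terms.\<close>

definition diag_sum :: "nat \<Rightarrow> nat \<Rightarrow> rat fps" where
  "diag_sum s k = fsum (\<lambda>n. Q ^ (Suc s * n) * delannoy Q n (n + k))"

lemma loc_finite_diag_sum: "loc_finite (\<lambda>n. Q ^ (Suc s * n) * delannoy Q n (n + k))"
  unfolding Q_power by (rule loc_finite_natI) simp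

lemma loc_finite_diag_sum_Suc: "loc_finite (\<lambda>n. Q ^ (Suc s * Suc n) * delannoy Q (Suc n) (Suc n + k))"
  by (rule loc_finite_inj[OF loc_finite_diag_sum]) simp

lemma diag_sum_Suc: "diag_sum s k = 1 + fsum (\<lambda>n. Q ^ (Suc s * Suc n) * delannoy Q (Suc n) (Suc n + k))"
  unfolding diag_sum_def by (subst fsum_nat_Suc[OF loc_finite_diag_sum]) simp

lemma power_Suc_1_mult: "(q :: 'a::comm_ring_1) ^ (Suc 1 * m) = q ^ m * q ^ m"
  by (simp flip: power_add)

lemma delannoy_diag_rec1:
  "q ^ (Suc 0 * Suc n) * delannoy q (Suc n) (Suc n + Suc k)
    = (q ^ (Suc 1 * Suc n) * delannoy q (Suc n) (Suc n + k) + q * (q ^ (Suc 0 * n) * delannoy q n (n + Suc (Suc k))))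
      + q * (q ^ (Suc 1 * n) * delannoy q n (n + Suc k))"
  unfolding power_Suc_1_mult by (simp add: algebra_simps)

lemma delannoy_diag_rec2:
  "q ^ (Suc 0 * Suc n) * delannoy q (Suc n) (Suc n + Suc k)
    = (q ^ (Suc 0 * Suc n) * delannoy q (Suc n) (Suc n + k)
        + q ^ (k + 3) * (q ^ (Suc 1 * n) * delannoy q n (n + Suc (Suc k))))
      + q ^ (k + 2) * (q ^ (Suc 1 * n) * delannoy q n (n + Suc k))"
  unfolding power_Suc_1_mult add_Suc delannoy_rec2 add_Suc_right
  by (simp add: algebra_simps power_add eval_nat_numeral del: delannoy.simps)

lemma delannoy_diag_rec0:
  "q ^ (Suc 0 * Suc n) * delannoy q (Suc n) (Suc n + 0)
    = (q ^ 2 * (q ^ (Suc 1 * n) * delannoy q n (n + 1)) + q * (q ^ (Suc 0 * n) * delannoy q n (n + 1)))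
      + q * (q ^ (Suc 1 * n) * delannoy q n (n + 0))"
  unfolding power_Suc_1_mult add_0_right add_Suc delannoy.simps(3) delannoy_sym[of q "Suc n" n]
  by (simp add: algebra_simps power2_eq_square del: delannoy.simps)

lemma diag_sum_rec1: "diag_sum 0 (Suc k) = diag_sum 1 k + Q * diag_sum 0 (Suc (Suc k)) + Q * diag_sum 1 (Suc k)"
  unfolding diag_sum_Suc[of 0 "Suc k"] delannoy_diag_rec1
  by (simp only: fsum_add loc_finite_add loc_finite_cmult loc_finite_diag_sum loc_finite_diag_sum_Suc fsum_cmult diag_sum_Suc[of 1 k])
    (simp only: diag_sum_def add.assoc)

lemma diag_sum_rec2:
  "diag_sum 0 (Suc k) = diag_sum 0 k + Q ^ (k + 3) * diag_sum 1 (Suc (Suc k)) + Q ^ (k + 2) * diag_sum 1 (Suc k)"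
  unfolding diag_sum_Suc[of 0 "Suc k"] delannoy_diag_rec2
  by (simp only: fsum_add loc_finite_add loc_finite_cmult loc_finite_diag_sum loc_finite_diag_sum_Suc fsum_cmult diag_sum_Suc[of 0 k])
    (simp only: diag_sum_def add.assoc)

lemma diag_sum_rec0: "diag_sum 0 0 + Q ^ 2 * diag_sum 0 2 = 1 + 2 * Q * diag_sum 0 1"
proof -
  have "diag_sum 0 0 = 1 + (Q ^ 2 * diag_sum 1 1 + Q * diag_sum 0 1 + Q * diag_sum 1 0)"
    unfolding diag_sum_Suc[of 0 0] delannoy_diag_rec0
    by (simp only: fsum_add loc_finite_add loc_finite_cmult loc_finite_diag_sum loc_finite_diag_sum_Suc fsum_cmult) (simp only: diag_sum_def)
  moreover have "diag_sum 0 1 = diag_sum 1 0 + Q * diag_sum 0 2 + Q * diag_sum 1 1"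
    using diag_sum_rec1[of 0] by (simp add: numeral_2_eq_2)
  ultimately show ?thesis by algebra
qed

text \<open>The sums with s = 1 are eliminated: \<open>diag_sum_rec1\<close> at k + 1, multiplied by
  \<open>Q ^ (k + 2)\<close>, has the same s = 1 part as \<open>diag_sum_rec2\<close> at k. Hence
  the left side does not change from k to k + 1, and \<open>diag_sum_rec0\<close> gives its
  value.\<close>

lemma diag_sum_const: "diag_sum 0 k + Q ^ (k + 2) * diag_sum 0 (k + 2) = 1 + 2 * Q * diag_sum 0 1"
proof (induction k)
  case 0
  show ?case using diag_sum_rec0 by (simp only: add_0_left)
next
  case (Suc k)
  have "Q ^ (k + 2) * diag_sum 0 (k + 2) - Q ^ (k + 3) * diag_sum 0 (k + 3)
      = Q ^ (k + 2) * (diag_sum 1 (k + 1) + Q * diag_sum 1 (k + 2))"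
    using diag_sum_rec1[of "Suc k"] by (simp add: algebra_simps eval_nat_numeral)
  also have "\<dots> = diag_sum 0 (Suc k) - diag_sum 0 k"
    using diag_sum_rec2[of k] by (simp add: algebra_simps eval_nat_numeral)
  finally show ?case using Suc.IH by (simp add: algebra_simps eval_nat_numeral)
qed

text \<open>The solution of the recursion in \<open>diag_sum_const\<close> when its right side is
  replaced by 1, found by iterating that recursion.\<close>

definition partial_theta :: "nat \<Rightarrow> rat fps" where
  "partial_theta k = fsum (\<lambda>m. fps_X ^ (2 * (m * m + m + m * k)) * (-1) ^ m)"

lemma loc_finite_partial_theta: "loc_finite (\<lambda>m. fps_X ^ (2 * (m * m + m + m * k)) * (-1) ^ m)"
  by (rule loc_finite_natI) simp

lemma partial_theta_rec: "partial_theta k = 1 - Q ^ (k + 2) * partial_theta (k + 2)"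
proof -
  have "partial_theta k = 1 + fsum (\<lambda>m. - (Q ^ (k + 2)) * (fps_X ^ (2 * (m * m + m + m * (k + 2))) * (-1) ^ m))"
    unfolding partial_theta_def
    by (subst fsum_nat_Suc[OF loc_finite_partial_theta]) (simp add: Q_power algebra_simps flip: power_add)
  also have "\<dots> = 1 - Q ^ (k + 2) * partial_theta (k + 2)"
    unfolding partial_theta_def by (subst fsum_cmult[OF loc_finite_partial_theta]) simp
  finally show ?thesis .
qed

text \<open>Each use of the recursion gains a factor \<open>fps_X\<close>, so coefficient n of any
  member depends only on lower coefficients of a later member.\<close>

lemma eq_zero_if_X_power_rec:
  fixes d :: "nat \<Rightarrow> 'a::comm_ring_1 fps"
  assumes "\<And>k. d k = fps_X * h k * d (k + r)"
  shows "d k = 0"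
proof (rule fps_ext)
  fix n
  show "fps_nth (d k) n = fps_nth 0 n"
  proof (induction n arbitrary: k rule: less_induct)
    case (less n)
    show ?case
    proof (cases n)
      case 0
      then show ?thesis by (subst assms) simp
    next
      case (Suc m)
      have "fps_nth (d k) n = fps_nth (h k * d (k + r)) m"
        by (subst assms) (simp add: Suc mult.assoc)
      also have "\<dots> = 0" using less Suc by (simp add: fps_mult_nth)
      finally show ?thesis by simp
    qed
  qed
qed

text \<open>The difference of the two sides satisfies the homogeneous recursion d(k) = - Q^(k+2)
  d(k+2), whose only power series solution is 0.\<close>

lemma diag_sum_eq_partial_theta: "diag_sum 0 k = (1 + 2 * Q * diag_sum 0 1) * partial_theta k"
proof -
  have "diag_sum 0 k - (1 + 2 * Q * diag_sum 0 1) * partial_theta k = 0"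
  proof (rule eq_zero_if_X_power_rec[where d = "\<lambda>k. diag_sum 0 k - (1 + 2 * Q * diag_sum 0 1) * partial_theta k"
        and h = "\<lambda>k. - (fps_X * Q ^ (k + 1))" and r = 2])
    fix k
    let ?c = "1 + 2 * Q * diag_sum 0 1"
    have d: "diag_sum 0 k = ?c - Q ^ (k + 2) * diag_sum 0 (k + 2)"
      using diag_sum_const[of k] by (simp only: eq_diff_eq)
    have "diag_sum 0 k - ?c * partial_theta k = (?c - Q ^ (k + 2) * diag_sum 0 (k + 2)) - ?c * (1 - Q ^ (k + 2) * partial_theta (k + 2))"
      by (subst d, subst partial_theta_rec) (rule refl)
    also have "\<dots> = - (Q * Q ^ (k + 1)) * (diag_sum 0 (k + 2) - ?c * partial_theta (k + 2))"
      by (simp add: algebra_simps)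
    finally show "diag_sum 0 k - ?c * partial_theta k
        = fps_X * - (fps_X * Q ^ (k + 1)) * (diag_sum 0 (k + 2) - ?c * partial_theta (k + 2))"
      by (simp add: power2_eq_square mult.assoc)
  qed
  then show ?thesis by simp
qed

text \<open>The unknown constant c = 1 + 2 Q d(1) is determined by the case k = 1, where d(1) = c
  p(1): this says c (1 - 2 Q p(1)) = 1. The factor 1 - 2 Q p(1) is phi(-q^2).\<close>

lemma diag_sum_partial_theta_1: "(1 - 2 * Q * partial_theta 1) * diag_sum 0 k = partial_theta k"
proof -
  have "(1 + 2 * Q * diag_sum 0 1) * (1 - 2 * Q * partial_theta 1) = 1"
  proof -
    have "(1 + 2 * x * d) * (1 - 2 * x * p) = 1" if "d = (1 + 2 * x * d) * p" for x d p :: "rat fps"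
    proof -
      have "(1 + 2 * x * d) * (1 - 2 * x * p) = (1 + 2 * x * d) - 2 * x * ((1 + 2 * x * d) * p)"
        by (simp add: algebra_simps)
      then show ?thesis unfolding that[symmetric] by simp
    qed
    from this[OF diag_sum_eq_partial_theta] show ?thesis .
  qed
  then have "(1 - 2 * Q * partial_theta 1) * ((1 + 2 * Q * diag_sum 0 1) * partial_theta k) = partial_theta k"
    by (simp only: mult.assoc[symmetric] mult.commute[of "1 - _"] mult_1_left)
  then show ?thesis by (subst diag_sum_eq_partial_theta)
qed

text \<open>The pairs with n <= k and those with n > k are summed by diagonals separately, the
  latter after the symmetry of the Delannoy numbers; the shift by one in the second sum keeps the
  main diagonal from being counted twice.\<close>

lemma Abs_fps_b_diag_sum:
  "Abs_fps b = fsum (\<lambda>k. fps_X ^ k * diag_sum 0 k) + fsum (\<lambda>k. fps_X ^ Suc k * diag_sum 0 (Suc k))"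
proof -
  let ?g = "\<lambda>(n, k). fps_X ^ (n + k) * delannoy Q n k"
  let ?h1 = "\<lambda>(k, n). (n, n + k) :: nat \<times> nat" and ?h2 = "\<lambda>(k, n). (n + Suc k, n) :: nat \<times> nat"
  have i: "inj ?h1" "inj ?h2" by (auto simp: inj_def)
  have "Abs_fps b = fsum (\<lambda>p. ?g (?h1 p)) + fsum (\<lambda>p. ?g (?h2 p))"
    unfolding Abs_fps_b
  proof (rule fsum_split2[OF loc_finite_X_delannoy i])
    show "range ?h1 \<inter> range ?h2 = {}" by auto
    fix j :: "nat \<times> nat" assume j: "j \<notin> range ?h1" "j \<notin> range ?h2"
    obtain n k where nk: "j = (n, k)" by (cases j)
    consider "k = n + (k - n)" | "n = k + Suc (n - k - 1)" by linarith
    then have False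
    proof cases
      case 1
      then have "j = ?h1 (k - n, n)" using nk by simp
      then show False using j(1) by blast
    next
      case 2
      then have "j = ?h2 (n - k - 1, k)" using nk by simp
      then show False using j(2) by blast
    qed
    then show "?g j = 0" ..
  qed
  also have "fsum (\<lambda>p. ?g (?h1 p)) = fsum (\<lambda>k. fps_X ^ k * diag_sum 0 k)"
  proof -
    have "?g (?h1 (k, n)) = fps_X ^ k * (Q ^ (Suc 0 * n) * delannoy Q n (n + k))" for k n
      unfolding Q_power by (simp add: power_add mult_2 mult.left_commute mult.assoc)
    then show ?thesis
      by (subst fsum_Pair[OF loc_finite_inj[OF loc_finite_X_delannoy i(1)]]) (simp only: fsum_cmult[OF loc_finite_diag_sum] diag_sum_def)
  qed
  also have "fsum (\<lambda>p. ?g (?h2 p)) = fsum (\<lambda>k. fps_X ^ Suc k * diag_sum 0 (Suc k))"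
  proof -
    have "?g (?h2 (k, n)) = fps_X ^ Suc k * (Q ^ (Suc 0 * n) * delannoy Q n (n + Suc k))" for k n
      unfolding Q_power by (simp add: power_add mult_2 mult.left_commute mult.assoc delannoy_sym[of Q "Suc (n + k)" n])
    then show ?thesis
      by (subst fsum_Pair[OF loc_finite_inj[OF loc_finite_X_delannoy i(2)]]) (simp only: fsum_cmult[OF loc_finite_diag_sum] diag_sum_def)
  qed
  finally show ?thesis .
qed

lemma phi_mult_b:
  "(1 - 2 * Q * partial_theta 1) * Abs_fps b
    = fsum (\<lambda>k. fps_X ^ k * partial_theta k) + fsum (\<lambda>k. fps_X ^ Suc k * partial_theta (Suc k))"
proof -
  have a: "loc_finite (\<lambda>k. fps_X ^ k * diag_sum 0 k)" "loc_finite (\<lambda>k. fps_X ^ Suc k * diag_sum 0 (Suc k))"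
    by (rule loc_finite_natI, simp)+
  show ?thesis
    unfolding Abs_fps_b_diag_sum distrib_left fsum_cmult[OF a(1), symmetric] fsum_cmult[OF a(2), symmetric]
    by (simp only: mult.left_commute[of "1 - 2 * Q * partial_theta 1"] diag_sum_partial_theta_1)
qed

section \<open>Theta and Lerch sums to the base q^6\<close>

text \<open>Terms with a negative exponent are discarded, so products of such sums behave well only if no
  term with a nonzero coefficient has a negative exponent.\<close>

definition fmon :: "rat \<Rightarrow> int \<Rightarrow> rat fps" where
  "fmon c e = (if e < 0 then 0 else fps_const c * fps_X ^ nat e)"

definition mon_sum :: "('i \<Rightarrow> rat) \<Rightarrow> ('i \<Rightarrow> int) \<Rightarrow> rat fps" where
  "mon_sum w e = fsum (\<lambda>i. fmon (w i) (e i))"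

definition admissible :: "('i \<Rightarrow> rat) \<Rightarrow> ('i \<Rightarrow> int) \<Rightarrow> bool" where
  "admissible w e \<longleftrightarrow> (\<forall>i. w i \<noteq> 0 \<longrightarrow> 0 \<le> e i) \<and> (\<forall>n. finite {i. w i \<noteq> 0 \<and> e i = int n})"

lemma fmon_nth: "fps_nth (fmon c e) n = (if e = int n then c else 0)"
  by (auto simp: fmon_def fps_X_power_nth)

lemma fmon_0 [simp]: "fmon 0 e = 0"
  by (rule fps_ext) (simp add: fmon_nth)

lemma fmon_diff: "fmon (c - d) e = fmon c e - fmon d e"
  by (rule fps_ext) (simp add: fmon_nth)

lemma fmon_uminus: "fmon (- c) e = - fmon c e"
  by (rule fps_ext) (simp add: fmon_nth)

lemma fmon_mult:
  assumes "c \<noteq> 0 \<Longrightarrow> 0 \<le> e" "d \<noteq> 0 \<Longrightarrow> 0 \<le> e'"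
  shows "fmon c e * fmon d e' = fmon (c * d) (e + e')"
proof (cases "c = 0 \<or> d = 0")
  case False
  then have "0 \<le> e" "0 \<le> e'" using assms by auto
  then have "fmon c e * fmon d e' = fps_const c * fps_const d * (fps_X ^ nat e * fps_X ^ nat e')"
    by (simp add: fmon_def del: fps_const_mult)
  also have "\<dots> = fmon (c * d) (e + e')"
    using \<open>0 \<le> e\<close> \<open>0 \<le> e'\<close> by (simp add: fmon_def nat_add_distrib power_add)
  finally show ?thesis .
qed auto

lemma fmon_X_power: "fmon 1 (int n) = fps_X ^ n"
  by (simp add: fmon_def)

lemma loc_finite_fmon: "admissible w e \<Longrightarrow> loc_finite (\<lambda>i. fmon (w i) (e i))"
  unfolding loc_finite_def admissible_def fmon_nth by (auto elim!: allE intro: rev_finite_subset)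

lemma mon_sum_cong: "(\<And>i. w i = w' i) \<Longrightarrow> (\<And>i. w i \<noteq> 0 \<Longrightarrow> e i = e' i) \<Longrightarrow> mon_sum w e = mon_sum w' e'"
  unfolding mon_sum_def by (rule arg_cong[of _ _ fsum], rule ext) (metis fmon_0)

lemma mon_sum_uminus: "admissible w e \<Longrightarrow> mon_sum (\<lambda>i. - w i) e = - mon_sum w e"
  unfolding mon_sum_def fmon_uminus using fsum_cmult[OF loc_finite_fmon, of w e "-1"] by simp

lemma mon_sum_diff: "admissible w e \<Longrightarrow> admissible w' e \<Longrightarrow> mon_sum (\<lambda>i. w i - w' i) e = mon_sum w e - mon_sum w' e"
  unfolding mon_sum_def fmon_diff by (intro fsum_diff loc_finite_fmon)

lemma admissible_mult:
  assumes "admissible w e" "admissible w' e'"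
  shows "admissible (\<lambda>(i, j). w i * w' j) (\<lambda>(i, j). e i + e' j)"
proof -
  have "finite {p. (case p of (i, j) \<Rightarrow> w i * w' j) \<noteq> 0 \<and> (case p of (i, j) \<Rightarrow> e i + e' j) = int n}" for n
  proof (rule finite_subset)
    show "{p. (case p of (i, j) \<Rightarrow> w i * w' j) \<noteq> 0 \<and> (case p of (i, j) \<Rightarrow> e i + e' j) = int n}
        \<subseteq> (\<Union>k\<le>n. {i. w i \<noteq> 0 \<and> e i = int k} \<times> {j. w' j \<noteq> 0 \<and> e' j = int (n - k)})"
    proof
      fix p assume p: "p \<in> {p. (case p of (i, j) \<Rightarrow> w i * w' j) \<noteq> 0 \<and> (case p of (i, j) \<Rightarrow> e i + e' j) = int n}"
      obtain i j where ij: "p = (i, j)" by (cases p)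
      with p have w: "w i \<noteq> 0" "w' j \<noteq> 0" "e i + e' j = int n" by auto
      with assms have "0 \<le> e i" "0 \<le> e' j" by (auto simp: admissible_def)
      with w have "nat (e i) \<le> n" "e i = int (nat (e i))" "e' j = int (n - nat (e i))" by auto
      with w show "p \<in> (\<Union>k\<le>n. {i. w i \<noteq> 0 \<and> e i = int k} \<times> {j. w' j \<noteq> 0 \<and> e' j = int (n - k)})"
        unfolding ij by blast
    qed
    show "finite (\<Union>k\<le>n. {i. w i \<noteq> 0 \<and> e i = int k} \<times> {j. w' j \<noteq> 0 \<and> e' j = int (n - k)})"
      using assms by (intro finite_UN_I finite_atMost finite_cartesian_product) (simp_all only: admissible_def)
  qed
  with assms show ?thesis by (auto simp: admissible_def)
qed

lemma mon_sum_mult: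
  assumes "admissible w e" "admissible w' e'"
  shows "mon_sum w e * mon_sum w' e' = mon_sum (\<lambda>(i, j). w i * w' j) (\<lambda>(i, j). e i + e' j)"
proof -
  have "fmon (w i) (e i) * fmon (w' j) (e' j) = fmon (w i * w' j) (e i + e' j)" for i j
    using assms by (intro fmon_mult) (auto simp: admissible_def)
  then show ?thesis
    unfolding mon_sum_def fsum_mult[OF loc_finite_fmon[OF assms(1)] loc_finite_fmon[OF assms(2)]]
    by (simp add: case_prod_unfold)
qed

text \<open>The spare powers u and v absorb a constant difference between the exponents before and
  after the substitution, so that neither side acquires a negative exponent. Admissibility of the
  new family is inherited through h.\<close>

lemma mon_sum_reindex:
  fixes u v :: nat
  assumes "admissible w e" "bij h" "\<And>i. w' i = w (h i)"
    and "\<And>i. w' i \<noteq> 0 \<Longrightarrow> 0 \<le> e' i"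
    and "\<And>i. w' i \<noteq> 0 \<Longrightarrow> e' i + int v = e (h i) + int u"
  shows "fps_X ^ u * mon_sum w e = fps_X ^ v * mon_sum w' e'"
    and "admissible w' e'"
proof -
  have fin: "finite {i. w' i \<noteq> 0 \<and> e' i = int n}" for n
  proof -
    have f: "finite {j. w j \<noteq> 0 \<and> e j = int m}" for m using assms(1) by (simp add: admissible_def)
    have "{i. w' i \<noteq> 0 \<and> e' i = int n} \<subseteq> h -` {j. w j \<noteq> 0 \<and> e j = int (n + v - u)}"
    proof
      fix i assume i: "i \<in> {i. w' i \<noteq> 0 \<and> e' i = int n}"
      then have "w (h i) \<noteq> 0" "int n + int v = e (h i) + int u" using assms(3) assms(5)[of i] by auto
      moreover from this assms(1) have "0 \<le> e (h i)" by (auto simp: admissible_def)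
      ultimately show "i \<in> h -` {j. w j \<noteq> 0 \<and> e j = int (n + v - u)}" by auto
    qed
    then show ?thesis
      by (rule finite_subset) (use finite_vimageI[OF f] assms(2) in \<open>auto simp: bij_def\<close>)
  qed
  then show admissible: "admissible w' e'" using assms(4) by (auto simp: admissible_def)
  have "fps_X ^ u * mon_sum w e = fps_X ^ u * fsum (\<lambda>i. fmon (w (h i)) (e (h i)))"
    unfolding mon_sum_def by (subst fsum_bij[OF assms(2)]) (rule refl)
  also have "\<dots> = fsum (\<lambda>i. fps_X ^ u * fmon (w (h i)) (e (h i)))"
    using loc_finite_inj[OF loc_finite_fmon[OF assms(1)]] assms(2) by (subst fsum_cmult) (auto simp: bij_def)
  also have "\<dots> = fsum (\<lambda>i. fps_X ^ v * fmon (w' i) (e' i))"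
  proof (intro arg_cong[of _ _ fsum] ext)
    fix i
    show "fps_X ^ u * fmon (w (h i)) (e (h i)) = fps_X ^ v * fmon (w' i) (e' i)"
    proof (cases "w' i = 0")
      case False
      then have "w (h i) \<noteq> 0" by (simp add: assms(3))
      then have "0 \<le> e (h i)" using assms(1) by (simp add: admissible_def)
      have "fps_X ^ u * fmon (w (h i)) (e (h i)) = fmon (w' i) (int u + e (h i))"
        unfolding fmon_X_power[symmetric] using \<open>0 \<le> e (h i)\<close> by (subst fmon_mult) (auto simp: assms(3))
      also have "\<dots> = fps_X ^ v * fmon (w' i) (e' i)"
        unfolding fmon_X_power[symmetric] using assms(4,5)[OF False]
        by (subst fmon_mult) (auto simp: add.commute)
      finally show ?thesis .
    qed (simp add: assms(3)[symmetric])
  qed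
  also have "\<dots> = fps_X ^ v * mon_sum w' e'"
    unfolding mon_sum_def by (rule fsum_cmult[OF loc_finite_fmon[OF admissible]])
  finally show "fps_X ^ u * mon_sum w e = fps_X ^ v * mon_sum w' e'" .
qed

lemma mon_sum_bij:
  assumes "admissible w e" "bij h" "\<And>i. w' i = w (h i)" "\<And>i. e' i = e (h i)"
  shows "mon_sum w' e' = mon_sum w e" and "admissible w' e'"
proof -
  have "0 \<le> e' i" if "w' i \<noteq> 0" for i
    using that assms(1) by (simp add: assms(3,4) admissible_def)
  note r = mon_sum_reindex[OF assms(1,2), where u = 0 and v = 0 and w' = w' and e' = e', OF assms(3) this]
  show "mon_sum w' e' = mon_sum w e" using r(1) by (simp add: assms(4))
  show "admissible w' e'" using r(2) by (simp add: assms(4))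
qed

lemma admissible_intI:
  assumes "\<And>n. w n \<noteq> 0 \<Longrightarrow> 0 \<le> e n" "\<And>n :: int. w n \<noteq> 0 \<Longrightarrow> \<bar>n\<bar> \<le> e n + C"
  shows "admissible w e"
proof -
  have "finite {n. w n \<noteq> 0 \<and> e n = int m}" for m
  proof (rule finite_subset)
    show "{n. w n \<noteq> 0 \<and> e n = int m} \<subseteq> {- (int m + C)..int m + C}"
    proof
      fix n assume "n \<in> {n. w n \<noteq> 0 \<and> e n = int m}"
      with assms(2)[of n] show "n \<in> {- (int m + C)..int m + C}" by auto
    qed
  qed simp
  then show ?thesis using assms(1) by (simp add: admissible_def)
qed

lemma admissible_int_intI:
  assumes "\<And>k l. w (k, l) \<noteq> 0 \<Longrightarrow> 0 \<le> e (k, l)"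
    and "\<And>k l :: int. w (k, l) \<noteq> 0 \<Longrightarrow> \<bar>k\<bar> + \<bar>l\<bar> \<le> e (k, l) + C"
  shows "admissible w e"
proof -
  have "finite {p. w p \<noteq> 0 \<and> e p = int m}" for m
  proof (rule finite_subset)
    show "{p. w p \<noteq> 0 \<and> e p = int m} \<subseteq> {- (int m + C)..int m + C} \<times> {- (int m + C)..int m + C}"
    proof
      fix p assume p: "p \<in> {p. w p \<noteq> 0 \<and> e p = int m}"
      obtain k l where kl: "p = (k, l)" by (cases p)
      with p assms(2)[of k l] have "\<bar>k\<bar> + \<bar>l\<bar> \<le> int m + C" by simp
      then show "p \<in> {- (int m + C)..int m + C} \<times> {- (int m + C)..int m + C}" unfolding kl by auto
    qed
  qed simp
  then show ?thesis using assms(1) by (auto simp: admissible_def)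
qed

definition sn :: "int \<Rightarrow> rat" where "sn n = (if even n then 1 else - 1)"

text \<open>The value is 1 on the quadrant of nonnegative pairs, -1 on that of negative pairs and 0
  elsewhere. The additive form separates the two arguments, which makes differences with a common
  argument collapse.\<close>

definition sg :: "int \<Rightarrow> int \<Rightarrow> rat" where
  "sg k l = of_bool (0 \<le> k) + of_bool (0 \<le> l) - 1"

lemma sn_uminus: "sn (- n) = sn n" by (simp add: sn_def)
lemma sn_nonzero [simp]: "sn n \<noteq> 0" by (simp add: sn_def)

lemma sg_nonzero: "sg k l \<noteq> 0 \<longleftrightarrow> (0 \<le> k \<and> 0 \<le> l) \<or> (k < 0 \<and> l < 0)"
  by (auto simp: sg_def)

text \<open>Expanding \<open>1 / (1 - q^(6k + \<alpha>))\<close> into a geometric series in \<open>q^(6k + \<alpha>)\<close> or its inverse,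
  according to the sign of \<open>k\<close>, turns the Lerch sum of \<open>(-1)^k q^(3k^2 + rk + s) / (1 - q^(6k + \<alpha>))\<close>
  over all integers \<open>k\<close> into a sum over two opposite quadrants with signs \<open>sg\<close>; likewise for the
  Kronecker sum. The shift \<open>s\<close> keeps all exponents nonnegative; \<open>s = r^2\<close> always suffices.\<close>

definition theta :: "int \<Rightarrow> int \<Rightarrow> rat fps" where
  "theta r s = mon_sum sn (\<lambda>n. 3 * n * n + r * n + s)"

definition lerch :: "int \<Rightarrow> int \<Rightarrow> int \<Rightarrow> rat fps" where
  "lerch r \<alpha> s = mon_sum (\<lambda>(k, l). sn k * sg k l) (\<lambda>(k, l). 3 * k * k + r * k + 6 * k * l + \<alpha> * l + s)"

definition kronecker :: "int \<Rightarrow> int \<Rightarrow> rat fps" where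
  "kronecker \<alpha> \<beta> = mon_sum (\<lambda>(k, l). sg k l) (\<lambda>(k, l). 6 * k * l + \<alpha> * k + \<beta> * l)"

section \<open>Lower bounds for the exponents and admissibility\<close>

lemma abs_le_square_int: "\<bar>n\<bar> \<le> n * (n :: int)"
  using mult_left_mono[of 1 "\<bar>n\<bar>" "\<bar>n\<bar>"] by (cases "n = 0") (simp_all flip: abs_mult)

text \<open>Completing the square gives n^2 + rn + r^2 >= 0, and the remaining 2n^2 dominates the
  absolute value of n. This is why \<open>r * r\<close> serves as a uniform shift.\<close>

lemma quadratic_bound: "\<bar>n\<bar> \<le> 3 * n * n + r * n + r * (r :: int)"
proof -
  have "0 \<le> (2 * n + r) * (2 * n + r) + 3 * (r * r)" by simp
  then have "0 \<le> n * n + r * n + r * r" by (simp add: algebra_simps)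
  then show ?thesis using abs_le_square_int[of n] by (simp add: algebra_simps)
qed

lemma admissible_theta_square: "admissible sn (\<lambda>n. 3 * n * n + r * n + r * r)"
  by (rule admissible_intI[where C = 0]) (use quadratic_bound[of _ r] in \<open>auto intro: order_trans[OF abs_ge_zero]\<close>)

lemma theta_nonneg:
  assumes "\<bar>r\<bar> \<le> (3 :: int)" shows "0 \<le> 3 * n * n + r * n"
proof -
  have "\<bar>r * n\<bar> \<le> 3 * \<bar>n\<bar>" using assms by (simp add: abs_mult mult_right_mono)
  then show ?thesis using abs_le_square_int[of n] by linarith
qed

lemma admissible_theta_0: "\<bar>r\<bar> \<le> 3 \<Longrightarrow> admissible sn (\<lambda>n. 3 * n * n + r * n + 0)"
  by (rule admissible_intI[where C = "r * r"]) (use quadratic_bound[of _ r] theta_nonneg in auto)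

text \<open>As 0 < \<alpha> < 6, the integer 6k + \<alpha> is nonzero and has the sign of l on both
  quadrants.\<close>

lemma lerch_linear_bound:
  assumes "0 < \<alpha>" "\<alpha> < (6 :: int)" "(0 \<le> k \<and> 0 \<le> l) \<or> (k < 0 \<and> l < 0)"
  shows "\<bar>l\<bar> \<le> 6 * k * l + \<alpha> * l"
proof -
  have "1 * \<bar>l\<bar> \<le> \<bar>6 * k + \<alpha>\<bar> * \<bar>l\<bar>" using assms by (intro mult_right_mono) auto
  also have "\<dots> = (6 * k + \<alpha>) * l"
  proof -
    have "(0 \<le> 6 * k + \<alpha> \<and> 0 \<le> l) \<or> (6 * k + \<alpha> \<le> 0 \<and> l \<le> 0)" using assms by auto
    then show ?thesis unfolding abs_mult[symmetric] by (simp add: zero_le_mult_iff)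
  qed
  finally show ?thesis by (simp add: algebra_simps)
qed

lemma admissible_lerch_square:
  assumes "0 < \<alpha>" "\<alpha> < 6"
  shows "admissible (\<lambda>(k, l). sn k * sg k l) (\<lambda>(k, l). 3 * k * k + r * k + 6 * k * l + \<alpha> * l + r * r)"
proof (rule admissible_int_intI[where C = 0])
  fix k l assume "(case (k, l) of (k, l) \<Rightarrow> sn k * sg k l) \<noteq> 0"
  then have "\<bar>l\<bar> \<le> 6 * k * l + \<alpha> * l" using lerch_linear_bound[OF assms] by (simp add: sg_nonzero)
  with quadratic_bound[of k r]
  show "\<bar>k\<bar> + \<bar>l\<bar> \<le> (case (k, l) of (k, l) \<Rightarrow> 3 * k * k + r * k + 6 * k * l + \<alpha> * l + r * r) + 0"
    by simp
  then show "0 \<le> (case (k, l) of (k, l) \<Rightarrow> 3 * k * k + r * k + 6 * k * l + \<alpha> * l + r * r)" by simp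
qed

text \<open>The negative quadrant is reflected to nonnegative k', l'; the constant term of the
  reflected exponent is 9 - r - \<alpha>, which explains the bound on r + \<alpha>.\<close>

lemma lerch_nonneg:
  assumes "0 < \<alpha>" "\<alpha> < 6" "0 \<le> r" "r + \<alpha> \<le> (9 :: int)" "(0 \<le> k \<and> 0 \<le> l) \<or> (k < 0 \<and> l < 0)"
  shows "0 \<le> 3 * k * k + r * k + 6 * k * l + \<alpha> * l"
  using assms(5)
proof
  assume "0 \<le> k \<and> 0 \<le> l"
  then show ?thesis using assms by simp
next
  assume kl: "k < 0 \<and> l < 0"
  define k' l' where "k' = - 1 - k" and "l' = - 1 - l"
  have "0 \<le> k'" "0 \<le> l'" using kl by (auto simp: k'_def l'_def)
  then have "0 \<le> 3 * (k' * k') + (12 - r) * k' + 6 * (k' * l') + (6 - \<alpha>) * l' + (9 - r - \<alpha>)"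
    using assms by (intro add_nonneg_nonneg mult_nonneg_nonneg) auto
  also have "\<dots> = 3 * k * k + r * k + 6 * k * l + \<alpha> * l"
    by (simp add: k'_def l'_def algebra_simps)
  finally show ?thesis .
qed

lemma admissible_lerch_0:
  assumes "0 < \<alpha>" "\<alpha> < 6" "0 \<le> r" "r + \<alpha> \<le> 9"
  shows "admissible (\<lambda>(k, l). sn k * sg k l) (\<lambda>(k, l). 3 * k * k + r * k + 6 * k * l + \<alpha> * l + 0)"
proof (rule admissible_int_intI[where C = "r * r"])
  fix k l assume "(case (k, l) of (k, l) \<Rightarrow> sn k * sg k l) \<noteq> 0"
  then have kl: "(0 \<le> k \<and> 0 \<le> l) \<or> (k < 0 \<and> l < 0)" by (simp add: sg_nonzero)
  show "0 \<le> (case (k, l) of (k, l) \<Rightarrow> 3 * k * k + r * k + 6 * k * l + \<alpha> * l + 0)"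
    using lerch_nonneg[OF assms kl] by simp
  show "\<bar>k\<bar> + \<bar>l\<bar> \<le> (case (k, l) of (k, l) \<Rightarrow> 3 * k * k + r * k + 6 * k * l + \<alpha> * l + 0) + r * r"
    using lerch_linear_bound[OF assms(1,2) kl] quadratic_bound[of k r] by simp
qed

text \<open>After reflection of the negative quadrant the exponent has constant term 6 - \<alpha> -
  \<beta>, whence the bound on \<alpha> + \<beta>.\<close>

lemma admissible_kronecker:
  assumes "0 < \<alpha>" "0 < \<beta>" "\<alpha> + \<beta> \<le> 6"
  shows "admissible (\<lambda>(k, l). sg k l) (\<lambda>(k, l). 6 * k * l + \<alpha> * k + \<beta> * l)"
proof -
  have key: "0 \<le> 6 * k * l + \<alpha> * k + \<beta> * l \<and> \<bar>k\<bar> + \<bar>l\<bar> \<le> 6 * k * l + \<alpha> * k + \<beta> * l + 6"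
    if "sg k l \<noteq> 0" for k l
    using that unfolding sg_nonzero
  proof
    assume kl: "0 \<le> k \<and> 0 \<le> l"
    have "0 \<le> 6 * k * l" using kl by simp
    moreover have "1 * k \<le> \<alpha> * k" "1 * l \<le> \<beta> * l" using kl assms by (intro mult_right_mono; simp)+
    ultimately show ?thesis using kl by linarith
  next
    assume kl: "k < 0 \<and> l < 0"
    define k' l' where "k' = - 1 - k" and "l' = - 1 - l"
    have nn: "0 \<le> k'" "0 \<le> l'" using kl by (auto simp: k'_def l'_def)
    have e: "6 * k * l + \<alpha> * k + \<beta> * l = 6 * (k' * l') + (6 - \<alpha>) * k' + (6 - \<beta>) * l' + (6 - \<alpha> - \<beta>)"
      by (simp add: k'_def l'_def algebra_simps)
    have "0 \<le> 6 * (k' * l')" using nn by simp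
    moreover have "1 * k' \<le> (6 - \<alpha>) * k'" "1 * l' \<le> (6 - \<beta>) * l'"
      using nn assms by (intro mult_right_mono; simp)+
    moreover have "\<bar>k\<bar> = k' + 1" "\<bar>l\<bar> = l' + 1" using kl by (auto simp: k'_def l'_def)
    ultimately show ?thesis unfolding e using nn assms by linarith
  qed
  show ?thesis
    by (rule admissible_int_intI[where C = 6]) (use key in auto)
qed

text \<open>After the substitutions below all three products become sums over the same family of
  monomials, and their coefficients satisfy \<open>sg k t - sg (- l) t = sg (l - 1) k\<close>.\<close>

lemma sg_diff: "sg k t - sg (- l) t = sg (l - 1) k"
  by (auto simp: sg_def)

text \<open>This is the change-of-z rule for Appell-Lerch sums to the base q^6, cleared of
  denominators: both sums share the ratio q^\<gamma> of numerator to denominator variable. The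
  Kronecker sum is left as a double series instead of being written as a theta quotient.\<close>

lemma theta_lerch:
  assumes "0 < \<alpha>" "\<alpha> < \<beta>" "\<beta> < 6"
  shows "fps_X ^ nat ((\<gamma> + \<alpha> + \<beta>) * (\<gamma> + \<alpha> + \<beta>)) *
      (theta (\<gamma> + \<beta>) ((\<gamma> + \<beta>) * (\<gamma> + \<beta>)) * lerch (\<gamma> + \<alpha>) \<alpha> ((\<gamma> + \<alpha>) * (\<gamma> + \<alpha>))
       - theta (\<gamma> + \<alpha>) ((\<gamma> + \<alpha>) * (\<gamma> + \<alpha>)) * lerch (\<gamma> + \<beta>) \<beta> ((\<gamma> + \<beta>) * (\<gamma> + \<beta>)))
    = fps_X ^ nat (\<alpha> + (\<gamma> + \<alpha>) * (\<gamma> + \<alpha>) + (\<gamma> + \<beta>) * (\<gamma> + \<beta>)) *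
      (theta (\<gamma> + \<alpha> + \<beta>) ((\<gamma> + \<alpha> + \<beta>) * (\<gamma> + \<alpha> + \<beta>)) * kronecker \<alpha> (6 - \<beta>))"
proof -
  define w1 w2 w3 :: "int \<times> int \<times> int \<Rightarrow> rat" where
    "w1 = (\<lambda>(n, k, l). sn n * sg k (l + n - k))" and
    "w2 = (\<lambda>(n, k, l). sn n * sg (- l) (l + n - k))" and
    "w3 = (\<lambda>(n, k, l). sn n * sg (l - 1) k)"
  define e :: "int \<times> int \<times> int \<Rightarrow> int" where
    "e = (\<lambda>(n, k, l). 3 * n * n + (\<gamma> + \<alpha> + \<beta>) * n + 6 * k * l + \<alpha> * l - \<beta> * k
      + (\<gamma> + \<alpha>) * (\<gamma> + \<alpha>) + (\<gamma> + \<beta>) * (\<gamma> + \<beta>))"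
  \<comment> \<open>The substitutions bring the quadratic part of all three exponents to 3n^2 + 6kl.
    The shift l - 1 in \<open>h3\<close> turns the parameter 6 - \<beta> into -\<beta> and costs the
    constant \<alpha> that appears among the powers of X.\<close>
  define h1 h2 h3 :: "int \<times> int \<times> int \<Rightarrow> int \<times> int \<times> int" where
    "h1 = (\<lambda>(n, k, l). (n - k, k, l + n - k))" and
    "h2 = (\<lambda>(n, k, l). (l + n, - l, l + n - k))" and
    "h3 = (\<lambda>(n, k, l). (n, l - 1, k))"
  have bij: "bij h1" "bij h2" "bij h3"
    by (rule o_bij[where g = "\<lambda>(a, b, c). (a + b, b, c - a)"], (auto simp: h1_def fun_eq_iff)[2],
        rule o_bij[where g = "\<lambda>(a, b, c). (a + b, a - c, - b)"], (auto simp: h2_def fun_eq_iff)[2],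
        rule o_bij[where g = "\<lambda>(a, b, c). (a, c, b + 1)"], (auto simp: h3_def fun_eq_iff)[2])
  have \<alpha>\<beta>: "0 < \<beta>" "\<alpha> < 6" "0 < 6 - \<beta>" "\<alpha> + (6 - \<beta>) \<le> 6" using assms by auto
  note mult1 = admissible_mult[OF admissible_theta_square admissible_lerch_square[OF assms(1) \<alpha>\<beta>(2)]]
    mon_sum_mult[OF admissible_theta_square admissible_lerch_square[OF assms(1) \<alpha>\<beta>(2)]]
  note mult2 = admissible_mult[OF admissible_theta_square admissible_lerch_square[OF \<alpha>\<beta>(1) assms(3)]]
    mon_sum_mult[OF admissible_theta_square admissible_lerch_square[OF \<alpha>\<beta>(1) assms(3)]]
  note mult3 = admissible_mult[OF admissible_theta_square admissible_kronecker[OF assms(1) \<alpha>\<beta>(3,4)]]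
    mon_sum_mult[OF admissible_theta_square admissible_kronecker[OF assms(1) \<alpha>\<beta>(3,4)]]
  have "w1 i = (case h1 i of (n, p) \<Rightarrow> sn n * (case p of (k, l) \<Rightarrow> sn k * sg k l))" for i
    by (cases i) (auto simp: w1_def h1_def sn_def)
  moreover have "e i = (case h1 i of (n, p) \<Rightarrow> 3 * n * n + (\<gamma> + \<beta>) * n + (\<gamma> + \<beta>) * (\<gamma> + \<beta>)
      + (case p of (k, l) \<Rightarrow> 3 * k * k + (\<gamma> + \<alpha>) * k + 6 * k * l + \<alpha> * l + (\<gamma> + \<alpha>) * (\<gamma> + \<alpha>)))" for i
    by (cases i) (simp add: e_def h1_def algebra_simps)
  ultimately have p1: "mon_sum w1 e = theta (\<gamma> + \<beta>) ((\<gamma> + \<beta>) * (\<gamma> + \<beta>)) * lerch (\<gamma> + \<alpha>) \<alpha> ((\<gamma> + \<alpha>) * (\<gamma> + \<alpha>))"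
    and a1: "admissible w1 e"
    unfolding theta_def lerch_def mult1(2) by (rule mon_sum_bij[OF mult1(1) bij(1)])+
  have "w2 i = (case h2 i of (n, p) \<Rightarrow> sn n * (case p of (k, l) \<Rightarrow> sn k * sg k l))" for i
    by (cases i) (auto simp: w2_def h2_def sn_def)
  moreover have "e i = (case h2 i of (n, p) \<Rightarrow> 3 * n * n + (\<gamma> + \<alpha>) * n + (\<gamma> + \<alpha>) * (\<gamma> + \<alpha>)
      + (case p of (k, l) \<Rightarrow> 3 * k * k + (\<gamma> + \<beta>) * k + 6 * k * l + \<beta> * l + (\<gamma> + \<beta>) * (\<gamma> + \<beta>)))" for i
    by (cases i) (simp add: e_def h2_def algebra_simps)
  ultimately have p2: "mon_sum w2 e = theta (\<gamma> + \<alpha>) ((\<gamma> + \<alpha>) * (\<gamma> + \<alpha>)) * lerch (\<gamma> + \<beta>) \<beta> ((\<gamma> + \<beta>) * (\<gamma> + \<beta>))"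
    and a2: "admissible w2 e"
    unfolding theta_def lerch_def mult2(2) by (rule mon_sum_bij[OF mult2(1) bij(2)])+
  have w: "w3 i = w1 i - w2 i" for i
    by (cases i) (simp add: w1_def w2_def w3_def right_diff_distrib[symmetric] sg_diff)
  have "mon_sum w3 e = mon_sum w1 e - mon_sum w2 e"
    unfolding mon_sum_diff[OF a1 a2, symmetric] by (rule mon_sum_cong) (simp_all add: w)
  moreover have "fps_X ^ nat (\<alpha> + (\<gamma> + \<alpha>) * (\<gamma> + \<alpha>) + (\<gamma> + \<beta>) * (\<gamma> + \<beta>)) *
      (theta (\<gamma> + \<alpha> + \<beta>) ((\<gamma> + \<alpha> + \<beta>) * (\<gamma> + \<alpha> + \<beta>)) * kronecker \<alpha> (6 - \<beta>))
    = fps_X ^ nat ((\<gamma> + \<alpha> + \<beta>) * (\<gamma> + \<alpha> + \<beta>)) * mon_sum w3 e"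
    unfolding theta_def kronecker_def mult3(2)
  proof (rule mon_sum_reindex(1)[OF mult3(1) bij(3)])
    fix i
    show "w3 i = (case h3 i of (n, p) \<Rightarrow> sn n * (case p of (k, l) \<Rightarrow> sg k l))"
      by (cases i) (simp add: w3_def h3_def)
    assume "w3 i \<noteq> 0"
    \<comment> \<open>As \<open>w3\<close> is the difference of \<open>w1\<close> and
      \<open>w2\<close>, a nonzero coefficient of \<open>w3\<close> lies in the support of one of
      them, where the exponent is known to be nonnegative.\<close>
    then have "w1 i \<noteq> 0 \<or> w2 i \<noteq> 0" by (auto simp: w)
    then show "0 \<le> e i" using a1 a2 unfolding admissible_def by blast
    have "0 \<le> \<alpha> + (\<gamma> + \<alpha>) * (\<gamma> + \<alpha>) + (\<gamma> + \<beta>) * (\<gamma> + \<beta>)" using assms by simp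
    moreover have "0 \<le> (\<gamma> + \<alpha> + \<beta>) * (\<gamma> + \<alpha> + \<beta>)" by simp
    ultimately show "e i + int (nat ((\<gamma> + \<alpha> + \<beta>) * (\<gamma> + \<alpha> + \<beta>))) =
        (case h3 i of (n, p) \<Rightarrow> 3 * n * n + (\<gamma> + \<alpha> + \<beta>) * n + (\<gamma> + \<alpha> + \<beta>) * (\<gamma> + \<alpha> + \<beta>)
          + (case p of (k, l) \<Rightarrow> 6 * k * l + \<alpha> * k + (6 - \<beta>) * l))
        + int (nat (\<alpha> + (\<gamma> + \<alpha>) * (\<gamma> + \<alpha>) + (\<gamma> + \<beta>) * (\<gamma> + \<beta>)))"
      by (cases i) (simp add: e_def h3_def algebra_simps)
  qed
  ultimately show ?thesis unfolding p1 p2 by simp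
qed

section \<open>Reduction to small parameters and special values\<close>

lemma theta_square:
  assumes "\<bar>r\<bar> \<le> 3" shows "theta r (r * r) = fps_X ^ nat (r * r) * theta r 0"
proof -
  have "fps_X ^ nat (r * r) * theta r 0 = fps_X ^ 0 * theta r (r * r)"
    unfolding theta_def
  proof (rule mon_sum_reindex(1)[OF admissible_theta_0[OF assms], of "\<lambda>n. n"])
    show "0 \<le> 3 * n * n + r * n + r * r" for n
      using quadratic_bound[of n r] by linarith
  qed (simp_all add: bij_id[unfolded id_def])
  then show ?thesis by simp
qed

lemma theta_uminus: assumes "\<bar>r\<bar> \<le> 3" shows "theta (- r) 0 = theta r 0"
  unfolding theta_def
  by (rule mon_sum_bij(1)[OF admissible_theta_0[OF assms] bij_uminus]) (simp_all add: sn_uminus)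

lemma bij_minus_int: "bij (\<lambda>n :: int. a - n)"
  by (rule o_bij[where g = "\<lambda>n. a - n"]) (simp_all add: fun_eq_iff)

text \<open>The reflection n -> -1 - n preserves 3n^2 + 3n and reverses the sign, so the terms
  cancel in pairs. This zero is what isolates single Kronecker sums and single Lerch sums
  below.\<close>

lemma theta_3: "theta 3 0 = 0"
proof -
  have a: "admissible sn (\<lambda>n. 3 * n * n + 3 * n + 0)" by (rule admissible_theta_0) simp
  have "mon_sum (\<lambda>n. - sn n) (\<lambda>n. 3 * n * n + 3 * n + 0) = mon_sum sn (\<lambda>n. 3 * n * n + 3 * n + 0)"
    by (rule mon_sum_bij(1)[OF a bij_minus_int[of "- 1"]]) (simp_all add: sn_def algebra_simps)
  then show ?thesis unfolding mon_sum_uminus[OF a] theta_def by simp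
qed

text \<open>Quasi-periodicity: the shift n -> n - 1 lowers the parameter by 6, changes the sign and
  leaves a power of X.\<close>

lemma theta_square_shift:
  assumes "3 \<le> r" "r \<le> 9"
  shows "theta r (r * r) = - (fps_X ^ nat (r * r - r + 3) * theta (r - 6) 0)"
proof -
  have a: "admissible sn (\<lambda>n. 3 * n * n + (r - 6) * n + 0)" by (rule admissible_theta_0) (use assms in simp)
  have "fps_X ^ 0 * theta r (r * r) = fps_X ^ nat (r * r - r + 3) * mon_sum (\<lambda>n. - sn n) (\<lambda>n. 3 * n * n + (r - 6) * n + 0)"
    unfolding theta_def
  proof (rule mon_sum_reindex(1)[OF admissible_theta_square, of "\<lambda>n. n - 1"])
    show "bij (\<lambda>n :: int. n - 1)"
      by (rule o_bij[where g = "\<lambda>n. n + 1"]) (simp_all add: fun_eq_iff)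
    show "0 \<le> 3 * n * n + (r - 6) * n + 0" for n
      using a by (simp add: admissible_def)
    have "0 \<le> r * r - r + 3" using abs_le_square_int[of r] by linarith
    then show "3 * n * n + (r - 6) * n + 0 + int (nat (r * r - r + 3))
        = 3 * (n - 1) * (n - 1) + r * (n - 1) + r * r + int 0" for n
      by (simp add: algebra_simps)
  qed (simp add: sn_def)
  then show ?thesis unfolding mon_sum_uminus[OF a] by (simp add: theta_def)
qed

lemma lerch_square:
  assumes "0 < \<alpha>" "\<alpha> < 6" "0 \<le> r" "r + \<alpha> \<le> 9"
  shows "lerch r \<alpha> (r * r) = fps_X ^ nat (r * r) * lerch r \<alpha> 0"
proof -
  have "fps_X ^ nat (r * r) * lerch r \<alpha> 0 = fps_X ^ 0 * lerch r \<alpha> (r * r)"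
    unfolding lerch_def
  proof (rule mon_sum_reindex(1)[OF admissible_lerch_0[OF assms], of "\<lambda>n. n"])
    fix i assume "(case i of (k, l) \<Rightarrow> sn k * sg k l) \<noteq> 0"
    then show "0 \<le> (case i of (k, l) \<Rightarrow> 3 * k * k + r * k + 6 * k * l + \<alpha> * l + r * r)"
      using admissible_lerch_square[OF assms(1,2), of r] unfolding admissible_def by blast
  qed (auto simp: bij_id[unfolded id_def])
  then show ?thesis by simp
qed

lemma bij_reflect: "bij (\<lambda>(k, l). (- 1 - k, - 1 - l) :: int \<times> int)"
  by (rule o_bij[where g = "\<lambda>(k, l). (- 1 - k, - 1 - l)"]) (auto simp: fun_eq_iff)

text \<open>The reflection of both indices exchanges the two quadrants; \<open>sn\<close> and
  \<open>sg\<close> both change sign, so no sign remains.\<close>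

lemma lerch_square_reflect:
  assumes "0 < \<alpha>" "\<alpha> < 6" "r \<le> 12" "9 \<le> r + \<alpha>"
  shows "lerch r \<alpha> (r * r) = fps_X ^ nat (r * r + 9 - r - \<alpha>) * lerch (12 - r) (6 - \<alpha>) 0"
proof -
  have a: "admissible (\<lambda>(k, l). sn k * sg k l)
      (\<lambda>(k, l). 3 * k * k + (12 - r) * k + 6 * k * l + (6 - \<alpha>) * l + 0)"
    by (rule admissible_lerch_0) (use assms in auto)
  have "fps_X ^ 0 * lerch r \<alpha> (r * r) = fps_X ^ nat (r * r + 9 - r - \<alpha>) * lerch (12 - r) (6 - \<alpha>) 0"
    unfolding lerch_def
  proof (rule mon_sum_reindex(1)[OF admissible_lerch_square[OF assms(1,2)] bij_reflect])
    fix i :: "int \<times> int"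
    show "(case i of (k, l) \<Rightarrow> sn k * sg k l)
        = (case case i of (k, l) \<Rightarrow> (- 1 - k, - 1 - l) of (k, l) \<Rightarrow> sn k * sg k l)"
      by (cases i) (auto simp: sn_def sg_def)
    have "0 \<le> r * r + 9 - r - \<alpha>" using abs_le_square_int[of r] assms by linarith
    then show "(case i of (k, l) \<Rightarrow> 3 * k * k + (12 - r) * k + 6 * k * l + (6 - \<alpha>) * l + 0)
        + int (nat (r * r + 9 - r - \<alpha>))
      = (case case i of (k, l) \<Rightarrow> (- 1 - k, - 1 - l) of
          (k, l) \<Rightarrow> 3 * k * k + r * k + 6 * k * l + \<alpha> * l + r * r) + int 0"
      by (cases i) (simp add: algebra_simps)
    assume "(case i of (k, l) \<Rightarrow> sn k * sg k l) \<noteq> 0"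
    then show "0 \<le> (case i of (k, l) \<Rightarrow> 3 * k * k + (12 - r) * k + 6 * k * l + (6 - \<alpha>) * l + 0)"
      using a unfolding admissible_def by blast
  qed
  then show ?thesis by simp
qed

text \<open>Shifting l by one multiplies the k-th geometric series by q^(6k + \<alpha>), which
  raises the numerator parameter by 6. The right side is the form in which the dissection produces
  this sum for the residue class 0.\<close>

lemma lerch_shift:
  assumes "0 < \<alpha>" "0 \<le> r" "r + \<alpha> \<le> 3"
  shows "fps_X ^ nat \<alpha> * lerch (r + 6) \<alpha> 0
    = mon_sum (\<lambda>(k, l). sn k * sg k (l - 1)) (\<lambda>(k, l). 3 * k * k + r * k + 6 * k * l + \<alpha> * l + 0)"
proof -
  have a6: "admissible (\<lambda>(k, l). sn k * sg k l) (\<lambda>(k, l). 3 * k * k + (r + 6) * k + 6 * k * l + \<alpha> * l + 0)"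
    by (rule admissible_lerch_0) (use assms in auto)
  let ?h = "\<lambda>(k, l). (k, l - 1) :: int \<times> int"
  have bij: "bij ?h"
    by (rule o_bij[where g = "\<lambda>(k, l). (k, l + 1)"]) (auto simp: fun_eq_iff)
  have e: "(case i of (k, l) \<Rightarrow> 3 * k * k + r * k + 6 * k * l + \<alpha> * l + 0)
      = (case ?h i of (k, l) \<Rightarrow> 3 * k * k + (r + 6) * k + 6 * k * l + \<alpha> * l + 0) + \<alpha>" for i
    by (cases i) (simp add: algebra_simps)
  have w: "(case i of (k, l) \<Rightarrow> sn k * sg k (l - 1)) = (case ?h i of (k, l) \<Rightarrow> sn k * sg k l)" for i
    by (cases i) simp
  have "fps_X ^ nat \<alpha> * lerch (r + 6) \<alpha> 0 = fps_X ^ 0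
      * mon_sum (\<lambda>(k, l). sn k * sg k (l - 1)) (\<lambda>(k, l). 3 * k * k + r * k + 6 * k * l + \<alpha> * l + 0)"
    unfolding lerch_def
  proof (rule mon_sum_reindex(1)[OF a6 bij w])
    fix i
    show "(case i of (k, l) \<Rightarrow> 3 * k * k + r * k + 6 * k * l + \<alpha> * l + 0) + int 0
        = (case ?h i of (k, l) \<Rightarrow> 3 * k * k + (r + 6) * k + 6 * k * l + \<alpha> * l + 0) + int (nat \<alpha>)"
      unfolding e using assms by simp
    assume "(case i of (k, l) \<Rightarrow> sn k * sg k (l - 1)) \<noteq> 0"
    then have "0 \<le> (case ?h i of (k, l) \<Rightarrow> 3 * k * k + (r + 6) * k + 6 * k * l + \<alpha> * l + 0)"
      using a6 unfolding w admissible_def by blast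
    then show "0 \<le> (case i of (k, l) \<Rightarrow> 3 * k * k + r * k + 6 * k * l + \<alpha> * l + 0)"
      unfolding e using assms by simp
  qed
  then show ?thesis by simp
qed

lemma kronecker_commute: assumes "0 < \<alpha>" "0 < \<beta>" "\<alpha> + \<beta> \<le> 6" shows "kronecker \<beta> \<alpha> = kronecker \<alpha> \<beta>"
  unfolding kronecker_def
  by (rule mon_sum_bij(1)[OF admissible_kronecker[OF assms] bij_swap]) (auto simp: sg_def)

abbreviation \<theta>\<^sub>0 :: "rat fps" where "\<theta>\<^sub>0 \<equiv> theta 0 0"
abbreviation \<theta>\<^sub>1 :: "rat fps" where "\<theta>\<^sub>1 \<equiv> theta 1 0"
abbreviation \<theta>\<^sub>2 :: "rat fps" where "\<theta>\<^sub>2 \<equiv> theta 2 0"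
abbreviation L :: "int \<Rightarrow> int \<Rightarrow> rat fps" where "L r \<alpha> \<equiv> lerch r \<alpha> 0"

text \<open>The exchange relation with every theta and Lerch sum replaced by its normal form, a
  constant times a power of X times a series. N is a power of X common to all three terms;
  \<open>d1\<close>, \<open>d2\<close>, \<open>d3\<close> are what is left after its
  cancellation.\<close>

lemma theta_lerch_cancel:
  assumes "0 < \<alpha>" "\<alpha> < \<beta>" "\<beta> < 6"
    and "r1 = \<gamma> + \<beta>" "r2 = \<gamma> + \<alpha>" "r3 = \<gamma> + \<alpha> + \<beta>" "s1 = r1 * r1" "s2 = r2 * r2" "s3 = r3 * r3"
    and "theta r1 s1 = c1 * fps_X ^ p1 * t1" "theta r2 s2 = c2 * fps_X ^ p2 * t2"
    and "theta r3 s3 = c3 * fps_X ^ p3 * t3"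
    and "lerch r2 \<alpha> s2 = fps_X ^ m1 * l1" "lerch r1 \<beta> s1 = fps_X ^ m2 * l2"
    and "nat s3 + p1 + m1 = N + d1" "nat s3 + p2 + m2 = N + d2" "nat (\<alpha> + s2 + s1) + p3 = N + d3"
  shows "c1 * fps_X ^ d1 * (t1 * l1) - c2 * fps_X ^ d2 * (t2 * l2)
    = c3 * fps_X ^ d3 * (t3 * kronecker \<alpha> (6 - \<beta>))"
proof -
  have "fps_X ^ N * (c1 * fps_X ^ d1 * (t1 * l1) - c2 * fps_X ^ d2 * (t2 * l2))
      = c1 * t1 * l1 * fps_X ^ (N + d1) - c2 * t2 * l2 * fps_X ^ (N + d2)"
    by (simp add: power_add algebra_simps)
  also have "\<dots> = fps_X ^ nat s3 * (theta r1 s1 * lerch r2 \<alpha> s2 - theta r2 s2 * lerch r1 \<beta> s1)"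
    unfolding assms(15,16)[symmetric] assms(10,11,13,14) by (simp add: power_add algebra_simps)
  also have "\<dots> = fps_X ^ nat (\<alpha> + s2 + s1) * (theta r3 s3 * kronecker \<alpha> (6 - \<beta>))"
    using theta_lerch[OF assms(1-3), of \<gamma>] by (simp add: assms(4-9))
  also have "\<dots> = c3 * t3 * kronecker \<alpha> (6 - \<beta>) * fps_X ^ (N + d3)"
    unfolding assms(17)[symmetric] assms(12) by (simp add: power_add algebra_simps)
  also have "\<dots> = fps_X ^ N * (c3 * fps_X ^ d3 * (t3 * kronecker \<alpha> (6 - \<beta>)))"
    by (simp add: power_add algebra_simps)
  finally show ?thesis by simp
qed

text \<open>The vanishing cases 3 and 9 carry an arbitrary power and an arbitrary series so that
  they match the shape that \<open>theta_lerch_cancel\<close> expects.\<close>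

lemma theta_values:
  "theta 1 1 = 1 * fps_X ^ 1 * \<theta>\<^sub>1" "theta 2 4 = 1 * fps_X ^ 4 * \<theta>\<^sub>2" "theta 3 9 = 0 * fps_X ^ p * t"
  "theta 4 16 = - 1 * fps_X ^ 15 * \<theta>\<^sub>2" "theta 5 25 = - 1 * fps_X ^ 23 * \<theta>\<^sub>1" "theta 6 36 = - 1 * fps_X ^ 33 * \<theta>\<^sub>0"
  "theta 7 49 = - 1 * fps_X ^ 45 * \<theta>\<^sub>1" "theta 8 64 = - 1 * fps_X ^ 59 * \<theta>\<^sub>2" "theta 9 81 = 0 * fps_X ^ p * t"
  using theta_square[of 1] theta_square[of 2] theta_square[of 3] theta_square_shift[of 4] theta_square_shift[of 5]
    theta_square_shift[of 6] theta_square_shift[of 7] theta_square_shift[of 8] theta_square_shift[of 9]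
    theta_uminus[of 1] theta_uminus[of 2] theta_3
  by simp_all

lemma lerch_values:
  "lerch 1 1 1 = fps_X ^ 1 * L 1 1" "lerch 2 1 4 = fps_X ^ 4 * L 2 1" "lerch 3 1 9 = fps_X ^ 9 * L 3 1"
  "lerch 3 2 9 = fps_X ^ 9 * L 3 2" "lerch 3 3 9 = fps_X ^ 9 * L 3 3" "lerch 4 1 16 = fps_X ^ 16 * L 4 1"
  "lerch 4 3 16 = fps_X ^ 16 * L 4 3" "lerch 5 1 25 = fps_X ^ 25 * L 5 1" "lerch 5 2 25 = fps_X ^ 25 * L 5 2"
  "lerch 6 3 36 = fps_X ^ 36 * L 6 3" "lerch 6 5 36 = fps_X ^ 34 * L 6 1" "lerch 5 5 25 = fps_X ^ 24 * L 7 1"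
  "lerch 7 3 49 = fps_X ^ 48 * L 5 3"
  using lerch_square[of 1 1] lerch_square[of 1 2] lerch_square[of 1 3] lerch_square[of 2 3] lerch_square[of 3 3]
    lerch_square[of 1 4] lerch_square[of 3 4] lerch_square[of 1 5] lerch_square[of 2 5] lerch_square[of 3 6]
    lerch_square_reflect[of 5 6] lerch_square_reflect[of 5 5] lerch_square_reflect[of 3 7]
  by simp_all

text \<open>With \<gamma> = 3 - \<alpha> one of the two theta factors is \<open>theta 3 9\<close> =
  0, so the second Lerch sum disappears and the Kronecker sum is expressed by
  \<open>L 3 \<alpha>\<close> alone.\<close>

lemma theta_kronecker:
  assumes "0 < \<alpha>" "\<alpha> < \<beta>" "\<beta> < 6" "r1 = 3 - \<alpha> + \<beta>" "r3 = 3 + \<beta>" "s1 = r1 * r1" "s3 = r3 * r3"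
    and "theta r1 s1 = - 1 * fps_X ^ p1 * t1" "theta r3 s3 = - 1 * fps_X ^ p3 * t3"
    and "lerch 3 \<alpha> 9 = fps_X ^ 9 * l" "nat s3 + p1 + 9 = nat (\<alpha> + 9 + s1) + p3"
  shows "t1 * l = t3 * kronecker \<alpha> (6 - \<beta>)"
proof -
  have "- 1 * fps_X ^ 0 * (t1 * l) - 0 * fps_X ^ 0 * (0 * lerch r1 \<beta> s1)
      = - 1 * fps_X ^ 0 * (t3 * kronecker \<alpha> (6 - \<beta>))"
    \<comment> \<open>The term with coefficient 0 needs some exponents: \<open>p2\<close> =
      \<open>p1 + 9\<close> and \<open>m2\<close> = 0 are chosen to make its remaining power 0 as
      well.\<close>
    by (rule theta_lerch_cancel[OF assms(1-3), where ?r1.0 = r1 and ?r2.0 = 3 and ?r3.0 = r3 and \<gamma> = "3 - \<alpha>"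
          and ?s1.0 = s1 and ?s2.0 = 9 and ?s3.0 = s3 and ?p1.0 = p1 and ?p2.0 = "p1 + 9" and ?p3.0 = p3 and ?m1.0 = 9
          and ?m2.0 = 0 and N = "nat s3 + p1 + 9"])
      (use assms theta_values(3)[of 0 0] in simp_all)
  then show ?thesis by simp
qed

lemma kronecker_values:
  shows "\<theta>\<^sub>1 * L 3 1 = \<theta>\<^sub>0 * kronecker 1 3" and "\<theta>\<^sub>1 * L 3 1 = \<theta>\<^sub>2 * kronecker 1 1" and "\<theta>\<^sub>0 * L 3 1 = \<theta>\<^sub>1 * kronecker 1 2"
    and "\<theta>\<^sub>0 * L 3 2 = \<theta>\<^sub>2 * kronecker 1 2" and "\<theta>\<^sub>2 * L 3 1 = \<theta>\<^sub>1 * kronecker 1 4" and "\<theta>\<^sub>2 * L 3 2 = \<theta>\<^sub>0 * kronecker 2 3"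
    and "\<theta>\<^sub>1 * L 3 3 = \<theta>\<^sub>2 * kronecker 1 3"
proof -
  have "\<theta>\<^sub>1 * L 3 1 = \<theta>\<^sub>0 * kronecker 1 (6 - 3)"
    by (rule theta_kronecker[OF _ _ _ _ _ _ _ theta_values(5,6) lerch_values(3)]) simp_all
  then show "\<theta>\<^sub>1 * L 3 1 = \<theta>\<^sub>0 * kronecker 1 3" by simp
  have "\<theta>\<^sub>1 * L 3 1 = \<theta>\<^sub>2 * kronecker 1 (6 - 5)"
    by (rule theta_kronecker[OF _ _ _ _ _ _ _ theta_values(7,8) lerch_values(3)]) simp_all
  then show "\<theta>\<^sub>1 * L 3 1 = \<theta>\<^sub>2 * kronecker 1 1" by simp
  have "\<theta>\<^sub>0 * L 3 1 = \<theta>\<^sub>1 * kronecker 1 (6 - 4)"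
    by (rule theta_kronecker[OF _ _ _ _ _ _ _ theta_values(6,7) lerch_values(3)]) simp_all
  then show "\<theta>\<^sub>0 * L 3 1 = \<theta>\<^sub>1 * kronecker 1 2" by simp
  have "\<theta>\<^sub>0 * L 3 2 = \<theta>\<^sub>2 * kronecker 2 (6 - 5)"
    by (rule theta_kronecker[OF _ _ _ _ _ _ _ theta_values(6,8) lerch_values(4)]) simp_all
  then show "\<theta>\<^sub>0 * L 3 2 = \<theta>\<^sub>2 * kronecker 1 2" using kronecker_commute[of 1 2] by simp
  have "\<theta>\<^sub>2 * L 3 1 = \<theta>\<^sub>1 * kronecker 1 (6 - 2)"
    by (rule theta_kronecker[OF _ _ _ _ _ _ _ theta_values(4,5) lerch_values(3)]) simp_all
  then show "\<theta>\<^sub>2 * L 3 1 = \<theta>\<^sub>1 * kronecker 1 4" by simp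
  have "\<theta>\<^sub>2 * L 3 2 = \<theta>\<^sub>0 * kronecker 2 (6 - 3)"
    by (rule theta_kronecker[OF _ _ _ _ _ _ _ theta_values(4,6) lerch_values(4)]) simp_all
  then show "\<theta>\<^sub>2 * L 3 2 = \<theta>\<^sub>0 * kronecker 2 3" by simp
  have "\<theta>\<^sub>1 * L 3 3 = \<theta>\<^sub>2 * kronecker 3 (6 - 5)"
    by (rule theta_kronecker[OF _ _ _ _ _ _ _ theta_values(5,8) lerch_values(5)]) simp_all
  then show "\<theta>\<^sub>1 * L 3 3 = \<theta>\<^sub>2 * kronecker 1 3" using kronecker_commute[of 1 3] by simp
qed

text \<open>The first three relations serve the residue class 3, the last two the class 4, and the
  first, fourth and fifth together give the quartic theta identity. The third has no Kronecker term
  because there \<gamma> + \<alpha> + \<beta> = 9, where the theta function vanishes.\<close>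

lemma lerch_relations:
  shows "\<theta>\<^sub>0 * L 4 1 - fps_X ^ 2 * (\<theta>\<^sub>2 * L 6 3) = \<theta>\<^sub>1 * kronecker 1 3"
    and "\<theta>\<^sub>0 * L 2 1 + fps_X * (\<theta>\<^sub>2 * L 6 1) = \<theta>\<^sub>1 * kronecker 1 1"
    and "\<theta>\<^sub>0 * L 4 3 = \<theta>\<^sub>2 * L 6 1"
    and "\<theta>\<^sub>1 * L 4 1 - fps_X * (\<theta>\<^sub>2 * L 5 2) = \<theta>\<^sub>0 * kronecker 1 4"
    and "\<theta>\<^sub>0 * L 5 2 - fps_X * (\<theta>\<^sub>1 * L 6 3) = \<theta>\<^sub>2 * kronecker 2 3"
    and "\<theta>\<^sub>1 * L 1 1 + fps_X * (\<theta>\<^sub>1 * L 7 1) = \<theta>\<^sub>0 * kronecker 1 1"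
    and "\<theta>\<^sub>1 * L 5 1 - fps_X * (\<theta>\<^sub>1 * L 5 3) = \<theta>\<^sub>2 * kronecker 1 3"
proof -
  have "- 1 * fps_X ^ 0 * (\<theta>\<^sub>0 * L 4 1) - - 1 * fps_X ^ 2 * (\<theta>\<^sub>2 * L 6 3) = - 1 * fps_X ^ 0 * (\<theta>\<^sub>1 * kronecker 1 (6 - 3))"
    by (rule theta_lerch_cancel[OF _ _ _ _ _ _ _ _ _ theta_values(6,4,7) lerch_values(6,10),
          where \<gamma> = 3 and N = 98]) simp_all
  from arg_cong[OF this, of uminus]
  show "\<theta>\<^sub>0 * L 4 1 - fps_X ^ 2 * (\<theta>\<^sub>2 * L 6 3) = \<theta>\<^sub>1 * kronecker 1 3" by simp
  have "- 1 * fps_X ^ 0 * (\<theta>\<^sub>0 * L 2 1) - 1 * fps_X ^ 1 * (\<theta>\<^sub>2 * L 6 1) = - 1 * fps_X ^ 0 * (\<theta>\<^sub>1 * kronecker 1 (6 - 5))"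
    by (rule theta_lerch_cancel[OF _ _ _ _ _ _ _ _ _ theta_values(6,2,7) lerch_values(2,11),
          where \<gamma> = 1 and N = 86]) simp_all
  from arg_cong[OF this, of uminus]
  show "\<theta>\<^sub>0 * L 2 1 + fps_X * (\<theta>\<^sub>2 * L 6 1) = \<theta>\<^sub>1 * kronecker 1 1" by (simp add: add.commute)
  have "- 1 * fps_X ^ 0 * (\<theta>\<^sub>0 * L 4 3) - - 1 * fps_X ^ 0 * (\<theta>\<^sub>2 * L 6 1) = 0 * fps_X ^ 0 * (0 * kronecker 3 (6 - 5))"
    by (rule theta_lerch_cancel[OF _ _ _ _ _ _ _ _ _ theta_values(6,4) theta_values(9)[of 75] lerch_values(7,11),
          where \<gamma> = 1 and N = 130]) simp_all
  then show "\<theta>\<^sub>0 * L 4 3 = \<theta>\<^sub>2 * L 6 1" by simp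
  have "- 1 * fps_X ^ 0 * (\<theta>\<^sub>1 * L 4 1) - - 1 * fps_X ^ 1 * (\<theta>\<^sub>2 * L 5 2) = - 1 * fps_X ^ 0 * (\<theta>\<^sub>0 * kronecker 1 (6 - 2))"
    by (rule theta_lerch_cancel[OF _ _ _ _ _ _ _ _ _ theta_values(5,4,6) lerch_values(6,9),
          where \<gamma> = 3 and N = 75]) simp_all
  from arg_cong[OF this, of uminus]
  show "\<theta>\<^sub>1 * L 4 1 - fps_X * (\<theta>\<^sub>2 * L 5 2) = \<theta>\<^sub>0 * kronecker 1 4" by simp
  have "- 1 * fps_X ^ 0 * (\<theta>\<^sub>0 * L 5 2) - - 1 * fps_X ^ 1 * (\<theta>\<^sub>1 * L 6 3) = - 1 * fps_X ^ 0 * (\<theta>\<^sub>2 * kronecker 2 (6 - 3))"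
    by (rule theta_lerch_cancel[OF _ _ _ _ _ _ _ _ _ theta_values(6,5,8) lerch_values(9,10),
          where \<gamma> = 3 and N = 122]) simp_all
  from arg_cong[OF this, of uminus]
  show "\<theta>\<^sub>0 * L 5 2 - fps_X * (\<theta>\<^sub>1 * L 6 3) = \<theta>\<^sub>2 * kronecker 2 3" by simp
  have "- 1 * fps_X ^ 0 * (\<theta>\<^sub>1 * L 1 1) - 1 * fps_X ^ 1 * (\<theta>\<^sub>1 * L 7 1) = - 1 * fps_X ^ 0 * (\<theta>\<^sub>0 * kronecker 1 (6 - 5))"
    by (rule theta_lerch_cancel[OF _ _ _ _ _ _ _ _ _ theta_values(5,1,6) lerch_values(1,12),
          where \<gamma> = 0 and N = 60]) simp_all
  from arg_cong[OF this, of uminus]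
  show "\<theta>\<^sub>1 * L 1 1 + fps_X * (\<theta>\<^sub>1 * L 7 1) = \<theta>\<^sub>0 * kronecker 1 1" by (simp add: add.commute)
  have "- 1 * fps_X ^ 0 * (\<theta>\<^sub>1 * L 5 1) - - 1 * fps_X ^ 1 * (\<theta>\<^sub>1 * L 5 3) = - 1 * fps_X ^ 0 * (\<theta>\<^sub>2 * kronecker 1 (6 - 3))"
    by (rule theta_lerch_cancel[OF _ _ _ _ _ _ _ _ _ theta_values(7,5,8) lerch_values(8,13),
          where \<gamma> = 4 and N = 134]) simp_all
  from arg_cong[OF this, of uminus]
  show "\<theta>\<^sub>1 * L 5 1 - fps_X * (\<theta>\<^sub>1 * L 5 3) = \<theta>\<^sub>2 * kronecker 1 3" by simp
qed

section \<open>Dissection modulo 6\<close>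

definition sect :: "nat \<Rightarrow> nat \<Rightarrow> rat fps \<Rightarrow> rat fps" where
  "sect m r f = Abs_fps (\<lambda>n. fps_nth f (m * n + r))"

lemma sect_nth: "fps_nth (sect m r f) n = fps_nth f (m * n + r)"
  by (simp add: sect_def)

lemma sect_add: "sect m r (f + g) = sect m r f + sect m r g"
  by (rule fps_ext) (simp add: sect_nth)

lemma sect_diff: "sect m r (f - g) = sect m r f - sect m r g"
  by (rule fps_ext) (simp add: sect_nth)

lemma sect_uminus: "sect m r (- f) = - sect m r f"
  by (rule fps_ext) (simp add: sect_nth)

lemma fsum_uminus: "fsum (\<lambda>i. - g i) = - fsum g"
  by (rule fps_ext) (simp add: fsum_nth sum_negf)

lemma sect_numeral: "sect m r (numeral k * f) = numeral k * sect m r f"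
  by (rule fps_ext) (simp add: sect_nth numeral_fps_const)

lemma loc_finite_sect: "loc_finite g \<Longrightarrow> loc_finite (\<lambda>i. sect m r (g i))"
  by (simp add: loc_finite_def sect_nth)

lemma sect_fsum: "sect m r (fsum g) = fsum (\<lambda>i. sect m r (g i))"
  by (rule fps_ext) (simp add: sect_nth fsum_nth)

lemma sect_X_power_le: "s \<le> r \<Longrightarrow> sect m r (fps_X ^ s * f) = sect m (r - s) f"
  by (rule fps_ext) (simp add: sect_nth fps_X_power_mult_nth)

lemma sect_X_power_gt:
  assumes "r < s" "s \<le> m + r"
  shows "sect m r (fps_X ^ s * f) = fps_X * sect m (m + r - s) f"
proof (rule fps_ext)
  fix n
  show "fps_nth (sect m r (fps_X ^ s * f)) n = fps_nth (fps_X * sect m (m + r - s) f) n"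
  proof (cases n)
    case (Suc k)
    have "m * Suc k + r - s = m * k + (m + r - s)" using assms by simp
    then show ?thesis using assms Suc by (simp add: sect_nth fps_X_power_mult_nth)
  qed (use assms in \<open>simp add: sect_nth fps_X_power_mult_nth\<close>)
qed

lemma sect_fmon:
  assumes "0 < m" "e = int m * e' + int r" "r < m"
  shows "sect m r (fmon c e) = fmon c e'"
proof (rule fps_ext)
  fix n
  have "e = int (m * n + r) \<longleftrightarrow> e' = int n" using assms by simp
  then show "fps_nth (sect m r (fmon c e)) n = fps_nth (fmon c e') n"
    by (simp add: sect_nth fmon_nth)
qed

lemma sect_fmon_eq_0:
  assumes "e mod int m \<noteq> int r" "r < m"
  shows "sect m r (fmon c e) = 0"
proof (rule fps_ext)
  fix n
  have "e \<noteq> int (m * n + r)" using assms by auto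
  then show "fps_nth (sect m r (fmon c e)) n = fps_nth 0 n"
    by (simp add: sect_nth fmon_nth)
qed

definition dilate :: "nat \<Rightarrow> rat fps \<Rightarrow> rat fps" where
  "dilate m f = Abs_fps (\<lambda>n. if m dvd n then fps_nth f (n div m) else 0)"

text \<open>A series in X^m does not move residue classes modulo m, so extraction is linear over
  such series.\<close>

lemma sect_dilate_mult:
  assumes "r < m" shows "sect m r (dilate m f * g) = f * sect m r g"
proof (rule fps_ext)
  fix n
  have "k \<le> n" if "m * k \<le> m * n + r" for k
    using div_le_mono[OF that, of m] assms by simp
  then have multiples: "{i \<in> {0..m * n + r}. m dvd i} = (\<lambda>i. m * i) ` {0..n}"
    using assms by (auto elim!: dvdE intro: trans_le_add1)
  have "fps_nth (sect m r (dilate m f * g)) n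
      = (\<Sum>i = 0..m * n + r. (if m dvd i then fps_nth f (i div m) else 0) * fps_nth g (m * n + r - i))"
    by (simp add: sect_nth fps_mult_nth dilate_def)
  also have "\<dots> = (\<Sum>i\<in>{i\<in>{0..m * n + r}. m dvd i}. fps_nth f (i div m) * fps_nth g (m * n + r - i))"
    by (rule sum.mono_neutral_cong_right) auto
  also have "\<dots> = (\<Sum>i = 0..n. fps_nth f i * fps_nth g (m * n + r - m * i))"
    unfolding multiples using assms by (subst sum.reindex) (auto simp: inj_on_def)
  also have "\<dots> = (\<Sum>i = 0..n. fps_nth f i * fps_nth g (m * (n - i) + r))"
    by (intro sum.cong refl) (simp add: diff_mult_distrib2)
  also have "\<dots> = fps_nth (f * sect m r g) n"
    by (simp add: sect_nth fps_mult_nth)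
  finally show "fps_nth (sect m r (dilate m f * g)) n = fps_nth (f * sect m r g) n" .
qed

lemma admissible_scale:
  assumes "admissible w e" "0 < c" shows "admissible w (\<lambda>i. int c * e i)"
proof -
  have "finite {i. w i \<noteq> 0 \<and> int c * e i = int n}" for n
  proof (rule finite_subset)
    show "{i. w i \<noteq> 0 \<and> int c * e i = int n} \<subseteq> {i. w i \<noteq> 0 \<and> e i = int (n div c)}"
    proof clarify
      fix i assume "int c * e i = int n"
      then have "int (n div c) = (int c * e i) div int c" by (simp add: zdiv_int)
      then show "e i = int (n div c)" using assms(2) by simp
    qed
    show "finite {i. w i \<noteq> 0 \<and> e i = int (n div c)}" using assms(1) by (simp add: admissible_def)
  qed
  with assms show ?thesis by (simp add: admissible_def)
qed

lemma dilate_mon_sum: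
  assumes "0 < m" shows "dilate m (mon_sum w e) = mon_sum w (\<lambda>i. int m * e i)"
proof (rule fps_ext)
  fix n
  show "fps_nth (dilate m (mon_sum w e)) n = fps_nth (mon_sum w (\<lambda>i. int m * e i)) n"
  proof (cases "m dvd n")
    case True
    then obtain k where "n = m * k" ..
    then show ?thesis using assms by (simp add: dilate_def mon_sum_def fsum_nth fmon_nth)
  next
    case False
    then have "int m * e i \<noteq> int n" for i by (metis dvd_triv_left int_dvd_int_iff)
    then show ?thesis using False by (simp add: dilate_def mon_sum_def fsum_nth fmon_nth)
  qed
qed

definition Lambert :: "rat fps" where
  "Lambert = mon_sum (\<lambda>(k, l). sn k * sg k l) (\<lambda>(k, l). 2 * k * k + 2 * k + (2 * k + 1) * l)"

lemma admissible_Lambert: "admissible (\<lambda>(k, l). sn k * sg k l) (\<lambda>(k, l). 2 * k * k + 2 * k + (2 * k + 1) * l)"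
proof -
  have key: "0 \<le> 2 * k * k + 2 * k + (2 * k + 1) * l
      \<and> \<bar>k\<bar> + \<bar>l\<bar> \<le> 2 * k * k + 2 * k + (2 * k + 1) * l + 1" if "sg k l \<noteq> 0" for k l
    using that unfolding sg_nonzero
  proof
    assume kl: "0 \<le> k \<and> 0 \<le> l"
    then have "0 \<le> 2 * (k * k)" "0 \<le> 2 * (k * l)" by simp_all
    then show ?thesis using kl by (simp add: algebra_simps)
  next
    assume kl: "k < 0 \<and> l < 0"
    define k' l' where "k' = - 1 - k" and "l' = - 1 - l"
    have nn: "0 \<le> k'" "0 \<le> l'" using kl by (auto simp: k'_def l'_def)
    then have "0 \<le> 2 * (k' * k')" "0 \<le> 2 * (k' * l')" by simp_all
    moreover have "2 * k * k + 2 * k + (2 * k + 1) * l = 2 * (k' * k') + 2 * (k' * l') + 4 * k' + l' + 1"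
      by (simp add: k'_def l'_def algebra_simps)
    moreover have "\<bar>k\<bar> = k' + 1" "\<bar>l\<bar> = l' + 1" using kl by (auto simp: k'_def l'_def)
    ultimately show ?thesis using nn by linarith
  qed
  show ?thesis by (rule admissible_int_intI[where C = 1]) (use key in auto)
qed

lemma range_nat_halves:
  shows "inj (\<lambda>m. int m)" "inj (\<lambda>m. - 1 - int m)"
    and "range (\<lambda>m. int m) \<inter> range (\<lambda>m. - 1 - int m) = {}"
    and "j \<notin> range (\<lambda>m. int m) \<Longrightarrow> j \<in> range (\<lambda>m. - 1 - int m)"
proof -
  show "inj (\<lambda>m. int m)" "inj (\<lambda>m. - 1 - int m)" by (auto simp: inj_def)
  show "range (\<lambda>m. int m) \<inter> range (\<lambda>m. - 1 - int m) = {}" by auto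
  assume j: "j \<notin> range (\<lambda>m. int m)"
  have "j < 0"
  proof (rule ccontr)
    assume "\<not> j < 0"
    then have "j = int (nat j)" by simp
    with j show False by blast
  qed
  then have "j = - 1 - int (nat (- 1 - j))" by simp
  then show "j \<in> range (\<lambda>m. - 1 - int m)" by blast
qed

lemma fmon_sn_power: "fmon (sn (int m)) (int n) = fps_X ^ n * (- 1) ^ m"
  by (cases "even m") (simp_all add: fmon_def sn_def fps_const_neg[symmetric] del: fps_const_neg)

text \<open>For fixed l the sum over k on the nonnegative quadrant is
  \<open>fps_X ^ l * partial_theta l\<close>; the reflected negative quadrant gives the same with l
  + 1. Hence k is the inner index, and the maps swap the components.\<close>

lemma Lambert_eq: "Lambert = fsum (\<lambda>k. fps_X ^ k * partial_theta k) + fsum (\<lambda>k. fps_X ^ Suc k * partial_theta (Suc k))"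
proof -
  let ?g = "\<lambda>p. fmon (case p of (k, l) \<Rightarrow> sn k * sg k l) (case p of (k, l) \<Rightarrow> 2 * k * k + 2 * k + (2 * k + 1) * l)"
  let ?h1 = "\<lambda>(l, m). (int m, int l)" and ?h2 = "\<lambda>(l, m). (- 1 - int m, - 1 - int l)"
  have loc_finite: "loc_finite ?g" by (rule loc_finite_fmon[OF admissible_Lambert])
  have i: "inj ?h1" "inj ?h2" by (auto simp: inj_def)
  have "Lambert = fsum (\<lambda>p. ?g (?h1 p)) + fsum (\<lambda>p. ?g (?h2 p))"
    unfolding Lambert_def mon_sum_def
  proof (rule fsum_split2[OF loc_finite i])
    show "range ?h1 \<inter> range ?h2 = {}" by auto
    fix p assume p: "p \<notin> range ?h1" "p \<notin> range ?h2"
    obtain k l where kl: "p = (k, l)" by (cases p)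
    have "sg k l = 0"
    proof (rule ccontr)
      assume "sg k l \<noteq> 0"
      then consider "p = ?h1 (nat l, nat k)" | "p = ?h2 (nat (- 1 - l), nat (- 1 - k))"
        unfolding kl sg_nonzero by auto
      then show False using p by cases blast+
    qed
    then show "?g p = 0" by (simp add: kl)
  qed
  also have "fsum (\<lambda>p. ?g (?h1 p)) = fsum (\<lambda>k. fps_X ^ k * partial_theta k)"
  proof -
    have "?g (?h1 (l, m)) = fps_X ^ l * (fps_X ^ (2 * (m * m + m + m * l)) * (- 1) ^ m)" for l m
    proof -
      have "?g (?h1 (l, m)) = fmon (sn (int m)) (int (l + 2 * (m * m + m + m * l)))"
        by (simp add: sg_def algebra_simps)
      then show ?thesis unfolding fmon_sn_power by (simp only: power_add mult.assoc)
    qed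
    then show ?thesis
      by (subst fsum_Pair[OF loc_finite_inj[OF loc_finite i(1)]]) (simp only: fsum_cmult[OF loc_finite_partial_theta] partial_theta_def)
  qed
  also have "fsum (\<lambda>p. ?g (?h2 p)) = fsum (\<lambda>k. fps_X ^ Suc k * partial_theta (Suc k))"
  proof -
    have "?g (?h2 (l, m)) = fps_X ^ Suc l * (fps_X ^ (2 * (m * m + m + m * Suc l)) * (- 1) ^ m)" for l m
    proof -
      have "sn (- 1 - int m) * sg (- 1 - int m) (- 1 - int l) = sn (int m)"
        by (auto simp: sn_def sg_def)
      then have "?g (?h2 (l, m)) = fmon (sn (int m)) (int (Suc l + 2 * (m * m + m + m * Suc l)))"
        by (simp add: algebra_simps)
      then show ?thesis unfolding fmon_sn_power by (simp only: power_add mult.assoc)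
    qed
    then show ?thesis
      by (subst fsum_Pair[OF loc_finite_inj[OF loc_finite i(2)]]) (simp only: fsum_cmult[OF loc_finite_partial_theta] partial_theta_def)
  qed
  finally show ?thesis .
qed

lemma mon_sum_square:
  assumes "0 < c"
  shows "mon_sum sn (\<lambda>n. int c * n * n) = 1 + 2 * fsum (\<lambda>m. fps_X ^ (c * (Suc m * Suc m)) * (- 1) ^ Suc m)"
proof -
  have a: "admissible sn (\<lambda>n. int c * n * n)"
  proof (rule admissible_intI[where C = 0])
    fix n :: int
    have "1 * (n * n) \<le> int c * (n * n)" using assms by (intro mult_right_mono) auto
    then show "\<bar>n\<bar> \<le> int c * n * n + 0" using abs_le_square_int[of n] by simp
    then show "0 \<le> int c * n * n" by simp
  qed
  note loc_finite = loc_finite_fmon[OF a]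
  have "mon_sum sn (\<lambda>n. int c * n * n) = fsum (\<lambda>m. fmon (sn (int m)) (int c * int m * int m))
      + fsum (\<lambda>m. fmon (sn (- 1 - int m)) (int c * (- 1 - int m) * (- 1 - int m)))"
    unfolding mon_sum_def
    by (rule fsum_split2[OF loc_finite range_nat_halves(1-3)]) (use range_nat_halves(4) in blast)
  also have "fsum (\<lambda>m. fmon (sn (int m)) (int c * int m * int m))
      = 1 + fsum (\<lambda>m. fmon (sn (int (Suc m))) (int c * int (Suc m) * int (Suc m)))"
    by (subst fsum_nat_Suc[OF loc_finite_inj[OF loc_finite range_nat_halves(1)]]) (simp add: fmon_def sn_def)
  also have "(\<lambda>m. fmon (sn (- 1 - int m)) (int c * (- 1 - int m) * (- 1 - int m)))
      = (\<lambda>m. fps_X ^ (c * (Suc m * Suc m)) * (- 1) ^ Suc m)"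
    unfolding fmon_sn_power[symmetric]
    by (rule ext, rule arg_cong2[of _ _ _ _ fmon]) (auto simp: sn_def algebra_simps)
  also have "(\<lambda>m. fmon (sn (int (Suc m))) (int c * int (Suc m) * int (Suc m)))
      = (\<lambda>m. fps_X ^ (c * (Suc m * Suc m)) * (- 1) ^ Suc m)"
    unfolding fmon_sn_power[symmetric]
    by (rule ext, rule arg_cong2[of _ _ _ _ fmon]) (auto simp: algebra_simps)
  finally show ?thesis by simp
qed

lemma phi_eq_mon_sum: "1 - 2 * Q * partial_theta 1 = mon_sum sn (\<lambda>n. 2 * n * n)"
proof -
  have "fsum (\<lambda>m. fps_X ^ (2 * (Suc m * Suc m)) * (- 1) ^ Suc m)
      = fsum (\<lambda>m. - Q * (fps_X ^ (2 * (m * m + m + m * 1)) * (- 1) ^ m))"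
    by (rule arg_cong[of _ _ fsum]) (simp add: fun_eq_iff algebra_simps power_add power2_eq_square)
  also have "\<dots> = - Q * partial_theta 1" unfolding partial_theta_def by (rule fsum_cmult[OF loc_finite_partial_theta])
  finally show ?thesis using mon_sum_square[of 2] by (simp add: algebra_simps)
qed

text \<open>The multiples n = 3k give theta_0(q^6). For n = 3k - 1 one has 2n^2 = 6(3k^2 - 2k) + 2
  with opposite sign, and n = 1 - 3k repeats these terms, hence the factor 2.\<close>

lemma phi_split: "1 - 2 * Q * partial_theta 1 = dilate 6 \<theta>\<^sub>0 - 2 * fps_X ^ 2 * dilate 6 \<theta>\<^sub>2"
proof -
  let ?g = "\<lambda>n. fmon (sn n) (2 * n * n)"
  let ?h0 = "\<lambda>k. 3 * k :: int" and ?h1 = "\<lambda>k. 3 * k - 1 :: int" and ?h2 = "\<lambda>k. 1 - 3 * k :: int"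
  have a: "admissible sn (\<lambda>n. 2 * n * n)"
  proof (rule admissible_intI[where C = 0])
    show "\<bar>n\<bar> \<le> 2 * n * n + 0" "0 \<le> 2 * n * n" for n :: int using abs_le_square_int[of n] by simp_all
  qed
  have g: "fmon (- sn k) (6 * (3 * k * k + (- 2) * k + 0) + 2)
      = - (fps_X ^ 2) * fmon (sn k) (int 6 * (3 * k * k + (- 2) * k + 0))" for k
  proof -
    have "fps_X ^ 2 * fmon (- sn k) (int 6 * (3 * k * k + (- 2) * k + 0))
        = fmon (- sn k) (6 * (3 * k * k + (- 2) * k + 0) + 2)"
      unfolding fmon_X_power[symmetric] using theta_nonneg[of "- 2" k] by (subst fmon_mult) (simp_all add: algebra_simps)
    from this[symmetric] show ?thesis by (simp only: fmon_uminus mult_minus_left mult_minus_right)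
  qed
  have g1: "?g (?h1 k) = - (fps_X ^ 2) * fmon (sn k) (int 6 * (3 * k * k + (- 2) * k + 0))" for k
    unfolding g[symmetric] by (rule arg_cong2[of _ _ _ _ fmon]) (auto simp: sn_def algebra_simps)
  have g2: "?g (?h2 k) = - (fps_X ^ 2) * fmon (sn k) (int 6 * (3 * k * k + (- 2) * k + 0))" for k
    unfolding g[symmetric] by (rule arg_cong2[of _ _ _ _ fmon]) (auto simp: sn_def algebra_simps)
  have "mon_sum sn (\<lambda>n. 2 * n * n) = fsum (\<lambda>k. ?g (?h0 k)) + fsum (\<lambda>k. ?g (?h1 k)) + fsum (\<lambda>k. ?g (?h2 k))"
    unfolding mon_sum_def
  proof (rule fsum_split3[OF loc_finite_fmon[OF a]])
    show "inj ?h0" "inj ?h1" "inj ?h2" by (auto simp: inj_def)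
    show "range ?h0 \<inter> range ?h1 = {}" "range ?h0 \<inter> range ?h2 = {}" "range ?h1 \<inter> range ?h2 = {}"
      by (auto, presburger+)
    fix n :: int assume n: "n \<notin> range ?h0" "n \<notin> range ?h1" "n \<notin> range ?h2"
    have "n = ?h0 (n div 3) \<or> n = ?h1 (n div 3 + 1) \<or> n = ?h2 (- (n div 3))" by presburger
    then show "?g n = 0" using n by blast
  qed
  also have "fsum (\<lambda>k. ?g (?h0 k)) = dilate 6 \<theta>\<^sub>0"
    unfolding theta_def by (subst dilate_mon_sum) (simp_all add: mon_sum_def sn_def algebra_simps)
  also have "(\<lambda>k. ?g (?h1 k)) = (\<lambda>k. - (fps_X ^ 2) * fmon (sn k) (int 6 * (3 * k * k + (- 2) * k + 0)))"
    using g1 by simp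
  also have "(\<lambda>k. ?g (?h2 k)) = (\<lambda>k. - (fps_X ^ 2) * fmon (sn k) (int 6 * (3 * k * k + (- 2) * k + 0)))"
    using g2 by simp
  also have "fsum (\<lambda>k. - (fps_X ^ 2) * fmon (sn k) (int 6 * (3 * k * k + (- 2) * k + 0)))
      = - (fps_X ^ 2) * dilate 6 \<theta>\<^sub>2"
  proof (subst fsum_cmult[OF loc_finite_fmon])
    have "admissible sn (\<lambda>n. 3 * n * n + (- 2) * n + 0)" by (rule admissible_theta_0) simp
    then show "admissible sn (\<lambda>n. int 6 * (3 * n * n + (- 2) * n + 0))"
      by (rule admissible_scale) simp
    show "- (fps_X ^ 2) * fsum (\<lambda>k. fmon (sn k) (int 6 * (3 * k * k + (- 2) * k + 0)))
        = - (fps_X ^ 2) * dilate 6 \<theta>\<^sub>2"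
      using theta_uminus[of 2] dilate_mon_sum[of 6 sn "\<lambda>n. 3 * n * n + (- 2) * n + 0"] by (simp add: theta_def mon_sum_def)
  qed
  finally show ?thesis unfolding phi_eq_mon_sum by simp
qed

text \<open>With c = 2 X^2 theta_2(X^6) this is (a - c)(a^2 + ac + c^2) = a^3 - c^3, whose right
  side contains only powers of X^6. The products are nested with the dilated factors outside so that
  extraction can strip them one by one.\<close>

lemma phi_cubic:
  "(dilate 6 \<theta>\<^sub>0 * (dilate 6 \<theta>\<^sub>0 * Lambert) + 2 * (fps_X ^ 2 * (dilate 6 \<theta>\<^sub>0 * (dilate 6 \<theta>\<^sub>2 * Lambert)))
      + 4 * (fps_X ^ 4 * (dilate 6 \<theta>\<^sub>2 * (dilate 6 \<theta>\<^sub>2 * Lambert))))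
    = dilate 6 \<theta>\<^sub>0 * (dilate 6 \<theta>\<^sub>0 * (dilate 6 \<theta>\<^sub>0 * Abs_fps b))
      - 8 * (fps_X ^ 6 * (dilate 6 \<theta>\<^sub>2 * (dilate 6 \<theta>\<^sub>2 * (dilate 6 \<theta>\<^sub>2 * Abs_fps b))))"
proof -
  have e: "Lambert = (dilate 6 \<theta>\<^sub>0 - 2 * fps_X ^ 2 * dilate 6 \<theta>\<^sub>2) * Abs_fps b"
    unfolding Lambert_eq phi_mult_b[symmetric] phi_split ..
  have "a * (a * ((a - 2 * x ^ 2 * o') * f)) + 2 * (x ^ 2 * (a * (o' * ((a - 2 * x ^ 2 * o') * f))))
      + 4 * (x ^ 4 * (o' * (o' * ((a - 2 * x ^ 2 * o') * f))))
    = a * (a * (a * f)) - 8 * (x ^ 6 * (o' * (o' * (o' * f))))" for a o' x f :: "rat fps"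
    by algebra
  then show ?thesis unfolding e .
qed

definition cub :: "rat fps" where "cub = \<theta>\<^sub>0 ^ 3 - 8 * fps_X * \<theta>\<^sub>2 ^ 3"

text \<open>The factors X^2 and X^4 lower the residue by 2 and 4: the class 3 meets 3, 1, 5 and the
  class 4 meets 4, 2, 0. Passing from 3 down to 5 wraps around, which produces the extra
  \<open>fps_X\<close>.\<close>

lemma cub_sect:
  "cub * sect 6 3 (Abs_fps b) = \<theta>\<^sub>0 ^ 2 * sect 6 3 Lambert + 2 * \<theta>\<^sub>0 * \<theta>\<^sub>2 * sect 6 1 Lambert
      + 4 * fps_X * \<theta>\<^sub>2 ^ 2 * sect 6 5 Lambert"
  "cub * sect 6 4 (Abs_fps b) = \<theta>\<^sub>0 ^ 2 * sect 6 4 Lambert + 2 * \<theta>\<^sub>0 * \<theta>\<^sub>2 * sect 6 2 Lambert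
      + 4 * \<theta>\<^sub>2 ^ 2 * sect 6 0 Lambert"
proof -
  have "\<theta>\<^sub>0 * (\<theta>\<^sub>0 * sect 6 3 Lambert) + 2 * (\<theta>\<^sub>0 * (\<theta>\<^sub>2 * sect 6 1 Lambert)) + 4 * (fps_X * (\<theta>\<^sub>2 * (\<theta>\<^sub>2 * sect 6 5 Lambert)))
      = \<theta>\<^sub>0 * (\<theta>\<^sub>0 * (\<theta>\<^sub>0 * sect 6 3 (Abs_fps b))) - 8 * (fps_X * (\<theta>\<^sub>2 * (\<theta>\<^sub>2 * (\<theta>\<^sub>2 * sect 6 3 (Abs_fps b)))))"
    using arg_cong[OF phi_cubic, of "sect 6 3"]
    by (simp add: sect_add sect_diff sect_numeral sect_X_power_le sect_X_power_gt sect_dilate_mult)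
  then show "cub * sect 6 3 (Abs_fps b) = \<theta>\<^sub>0 ^ 2 * sect 6 3 Lambert + 2 * \<theta>\<^sub>0 * \<theta>\<^sub>2 * sect 6 1 Lambert
      + 4 * fps_X * \<theta>\<^sub>2 ^ 2 * sect 6 5 Lambert"
    unfolding cub_def by algebra
  have "\<theta>\<^sub>0 * (\<theta>\<^sub>0 * sect 6 4 Lambert) + 2 * (\<theta>\<^sub>0 * (\<theta>\<^sub>2 * sect 6 2 Lambert)) + 4 * (\<theta>\<^sub>2 * (\<theta>\<^sub>2 * sect 6 0 Lambert))
      = \<theta>\<^sub>0 * (\<theta>\<^sub>0 * (\<theta>\<^sub>0 * sect 6 4 (Abs_fps b))) - 8 * (fps_X * (\<theta>\<^sub>2 * (\<theta>\<^sub>2 * (\<theta>\<^sub>2 * sect 6 4 (Abs_fps b)))))"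
    using arg_cong[OF phi_cubic, of "sect 6 4"]
    by (simp add: sect_add sect_diff sect_numeral sect_X_power_le sect_X_power_gt sect_dilate_mult)
  then show "cub * sect 6 4 (Abs_fps b) = \<theta>\<^sub>0 ^ 2 * sect 6 4 Lambert + 2 * \<theta>\<^sub>0 * \<theta>\<^sub>2 * sect 6 2 Lambert
      + 4 * \<theta>\<^sub>2 ^ 2 * sect 6 0 Lambert"
    unfolding cub_def by algebra
qed

section \<open>The residue classes of the Lerch sum\<close>

lemma sect_middle:
  "sect m r (fmon (sn (3 * k + 1) * sg (3 * k + 1) l)
      (2 * (3 * k + 1) * (3 * k + 1) + 2 * (3 * k + 1) + (2 * (3 * k + 1) + 1) * l))
    = - sect m r (fmon (sn k * sg k l) (6 * (3 * k * k + 3 * k + k * l) + 3 * l + 4))"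
proof -
  have w: "sn (3 * k + 1) * sg (3 * k + 1) l = - (sn k * sg k l)"
    by (auto simp: sn_def sg_def)
  have e: "2 * (3 * k + 1) * (3 * k + 1) + 2 * (3 * k + 1) + (2 * (3 * k + 1) + 1) * l
      = 6 * (3 * k * k + 3 * k + k * l) + 3 * l + 4"
    by (simp add: algebra_simps)
  show ?thesis unfolding w e fmon_uminus sect_uminus ..
qed

text \<open>In the class \<open>k = 2\<close> modulo \<open>3\<close> the reflection \<open>(k, l) \<mapsto> (- 1 - k, - l)\<close> leads back to the class \<open>0\<close>.\<close>

lemma sect_Lambert:
  fixes r :: nat
  assumes "r < 6"
  shows "sect 6 r Lambert = lerch (1 + int r) 1 0
    + fsum (\<lambda>(k, l). fmon (sn k * (if r = 0 then sg k (l - 1) else sg k l))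
        (3 * k * k + (1 + int r) * k + 6 * k * l + 1 * l + 0))
    - fsum (\<lambda>(k, l). sect 6 r (fmon (sn k * sg k l) (6 * (3 * k * k + 3 * k + k * l) + 3 * l + 4)))"
proof -
  let ?e = "\<lambda>(k, l). 2 * k * k + 2 * k + (2 * k + 1) * l :: int"
  let ?g = "\<lambda>p. sect 6 r (fmon (case p of (k, l) \<Rightarrow> sn k * sg k l) (?e p))"
  let ?h0 = "\<lambda>(k, l). (3 * k, 6 * l + int r) :: int \<times> int"
    and ?h1 = "\<lambda>(k, l). (- 1 - 3 * k, - (6 * l + int r)) :: int \<times> int"
    and ?h2 = "\<lambda>(k, l). (3 * k + 1, l) :: int \<times> int"
  have "sect 6 r Lambert = fsum (\<lambda>p. ?g (?h0 p)) + fsum (\<lambda>p. ?g (?h1 p)) + fsum (\<lambda>p. ?g (?h2 p))"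
    unfolding Lambert_def mon_sum_def sect_fsum
  proof (rule fsum_split3[OF loc_finite_sect[OF loc_finite_fmon[OF admissible_Lambert]]])
    show "inj ?h0" "inj ?h1" "inj ?h2" by (auto simp: inj_def)
    show "range ?h0 \<inter> range ?h1 = {}" "range ?h0 \<inter> range ?h2 = {}" "range ?h1 \<inter> range ?h2 = {}"
      by (auto, presburger+)
    fix p assume p: "p \<notin> range ?h0" "p \<notin> range ?h1" "p \<notin> range ?h2"
    obtain k l where kl: "p = (k, l)" by (cases p)
    have "?e p mod int 6 \<noteq> int r"
    proof
      assume mod: "?e p mod int 6 = int r"
      have "k = 3 * (k div 3) \<or> k = - 1 - 3 * (- (k div 3) - 1) \<or> k = 3 * (k div 3) + 1" by presburger
      then consider j where "k = 3 * j" | j where "k = - 1 - 3 * j" | j where "k = 3 * j + 1" by blast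
      then show False
      proof cases
        case 1
        have "?e p = l + 6 * (3 * j * j + j + j * l)" unfolding kl 1 by (simp add: algebra_simps)
        then have "l mod 6 = int r" using mod by (simp only: mod_mult_self2 of_nat_numeral)
        then have "p = ?h0 (j, l div 6)" unfolding kl 1 using div_mult_mod_eq[of l 6] by simp
        then show False using p(1) by blast
      next
        case 2
        have "?e p = - l + 6 * (3 * j * j + j - j * l)" unfolding kl 2 by (simp add: algebra_simps)
        then have "(- l) mod 6 = int r" using mod by (simp only: mod_mult_self2 of_nat_numeral)
        then have "p = ?h1 (j, (- l) div 6)" unfolding kl 2 using div_mult_mod_eq[of "- l" 6] by simp
        then show False using p(2) by blast
      next
        case 3
        then have "p = ?h2 (j, l)" unfolding kl by simp
        then show False using p(3) by blast
      qed
    qed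
    then show "?g p = 0" by (rule sect_fmon_eq_0) (fact assms)
  qed
  also have "(\<lambda>p. ?g (?h0 p)) = (\<lambda>p. fmon (case p of (k, l) \<Rightarrow> sn k * sg k l)
      (case p of (k, l) \<Rightarrow> 3 * k * k + (1 + int r) * k + 6 * k * l + 1 * l + 0))"
  proof
    fix p :: "int \<times> int"
    obtain k l where kl: "p = (k, l)" by (cases p)
    have w: "sn (3 * k) * sg (3 * k) (6 * l + int r) = sn k * sg k l"
      using assms by (auto simp: sn_def sg_def)
    show "?g (?h0 p) = fmon (case p of (k, l) \<Rightarrow> sn k * sg k l)
      (case p of (k, l) \<Rightarrow> 3 * k * k + (1 + int r) * k + 6 * k * l + 1 * l + 0)"
      unfolding kl prod.case w using assms by (intro sect_fmon) (simp_all add: algebra_simps)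
  qed
  also have "(\<lambda>p. ?g (?h1 p)) = (\<lambda>(k, l). fmon (sn k * (if r = 0 then sg k (l - 1) else sg k l))
        (3 * k * k + (1 + int r) * k + 6 * k * l + 1 * l + 0))"
  proof
    fix p :: "int \<times> int"
    obtain k l where kl: "p = (k, l)" by (cases p)
    \<comment> \<open>For 0 < r < 6 the number 6l + r is never 0, so negation exchanges the two
      signs exactly as for l. For r = 0 the index l = 0 is fixed by negation, and the threshold
      moves from 0 to 1.\<close>
    have w: "sn (- 1 - 3 * k) * sg (- 1 - 3 * k) (- (6 * l + int r))
        = sn k * (if r = 0 then sg k (l - 1) else sg k l)"
      using assms by (auto simp: sn_def sg_def)
    show "?g (?h1 p) = (case p of (k, l) \<Rightarrow> fmon (sn k * (if r = 0 then sg k (l - 1) else sg k l))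
        (3 * k * k + (1 + int r) * k + 6 * k * l + 1 * l + 0))"
      unfolding kl prod.case w using assms by (intro sect_fmon) (simp_all add: algebra_simps)
  qed
  also have "(\<lambda>p. ?g (?h2 p)) = (\<lambda>p. - (case p of (k, l) \<Rightarrow>
      sect 6 r (fmon (sn k * sg k l) (6 * (3 * k * k + 3 * k + k * l) + 3 * l + 4))))"
  proof
    fix p :: "int \<times> int"
    obtain k l where kl: "p = (k, l)" by (cases p)
    show "?g (?h2 p) = - (case p of (k, l) \<Rightarrow>
      sect 6 r (fmon (sn k * sg k l) (6 * (3 * k * k + 3 * k + k * l) + 3 * l + 4)))"
      unfolding kl prod.case by (rule sect_middle)
  qed
  also have "fsum (\<lambda>p. - (case p of (k, l) \<Rightarrow>
      sect 6 r (fmon (sn k * sg k l) (6 * (3 * k * k + 3 * k + k * l) + 3 * l + 4))))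
    = - fsum (\<lambda>(k, l). sect 6 r (fmon (sn k * sg k l) (6 * (3 * k * k + 3 * k + k * l) + 3 * l + 4)))"
    by (rule fsum_uminus)
  finally show ?thesis by (simp add: lerch_def mon_sum_def)
qed

lemma mon_sum_shift:
  assumes "admissible w e" shows "mon_sum w (\<lambda>i. e i + int s) = fps_X ^ s * mon_sum w e"
proof -
  have "fps_X ^ s * mon_sum w e = fps_X ^ 0 * mon_sum w (\<lambda>i. e i + int s)"
    by (rule mon_sum_reindex(1)[OF assms bij_id[unfolded id_def]]) (use assms in \<open>auto simp: admissible_def\<close>)
  then show ?thesis by simp
qed

text \<open>Modulo 6 the exponent is 3l + 4, which is 4 or 1 according to the parity of l; the terms
  with k = 1 modulo 3 therefore meet no other residue.\<close>

lemma sect_Lambert_middle_eq_0: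
  assumes "r = 0 \<or> r = 2 \<or> r = 3 \<or> r = (5 :: nat)"
  shows "fsum (\<lambda>(k, l). sect 6 r (fmon (sn k * sg k l) (6 * (3 * k * k + 3 * k + k * l) + 3 * l + 4))) = 0"
proof -
  have "sect 6 r (fmon c (6 * z + 3 * l + 4)) = 0" for c and z l :: int
  proof (rule sect_fmon_eq_0)
    show "(6 * z + 3 * l + 4) mod int 6 \<noteq> int r" using assms by (elim disjE) (simp, presburger)+
  qed (use assms in auto)
  then have "(\<lambda>(k, l). sect 6 r (fmon (sn k * sg k l) (6 * (3 * k * k + 3 * k + k * l) + 3 * l + 4)))
      = (\<lambda>p. 0)"
    by (simp only: split_def)
  then show ?thesis by (simp add: fps_eq_iff fsum_nth)
qed

text \<open>Fixing the parity t of l leaves denominators 1 - q^(2k+1); splitting l further modulo 3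
  turns them into 1 - q^(6k+3), which belongs to the base q^6. The third part would have numerator
  parameter 7 + t, beyond the bound of \<open>lerch_nonneg\<close>; reflection brings it to 5 -
  t.\<close>

lemma sect_Lambert_middle:
  assumes "t = 0 \<and> r = 4 \<or> t = 1 \<and> r = (1 :: nat)"
  shows "fsum (\<lambda>(k, l). sect 6 r (fmon (sn k * sg k l) (6 * (3 * k * k + 3 * k + k * l) + 3 * l + 4)))
    = fps_X ^ t * lerch (3 + int t) 3 0 + fps_X ^ (1 + t) * lerch (5 + int t) 3 0 + fps_X * lerch (5 - int t) 3 0"
proof -
  let ?e = "\<lambda>(k, l). 6 * (3 * k * k + 3 * k + k * l) + 3 * l + 4 :: int"
  let ?g = "\<lambda>p. sect 6 r (fmon (case p of (k, l) \<Rightarrow> sn k * sg k l) (?e p))"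
  let ?h0 = "\<lambda>(k, l). (k, 6 * l + int t) :: int \<times> int"
    and ?h1 = "\<lambda>(k, l). (k, 6 * l + 2 + int t) :: int \<times> int"
    and ?h2 = "\<lambda>(k, l). (- 1 - k, - 2 - 6 * l + int t) :: int \<times> int"
  have t: "t \<le> 1" using assms by auto
  have a: "admissible (\<lambda>(k, l). sn k * sg k l) (\<lambda>(k, l). 3 * k * k + s * k + 6 * k * l + 3 * l + 0)"
    if "0 \<le> s" "s \<le> 6" for s
    by (rule admissible_lerch_0) (use that in auto)
  have loc_finite: "loc_finite ?g"
  proof -
    let ?h = "\<lambda>(k, l). (3 * k + 1, l) :: int \<times> int"
    have "inj ?h" by (auto simp: inj_def)
    from loc_finite_uminus[OF loc_finite_inj[OF loc_finite_sect[OF loc_finite_fmon[OF admissible_Lambert]] this]]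
    show ?thesis by (simp only: split_def fst_conv snd_conv sect_middle minus_minus)
  qed
  have "fsum ?g = fsum (\<lambda>p. ?g (?h0 p)) + fsum (\<lambda>p. ?g (?h1 p)) + fsum (\<lambda>p. ?g (?h2 p))"
  proof (rule fsum_split3[OF loc_finite])
    show "inj ?h0" "inj ?h1" "inj ?h2" by (auto simp: inj_def)
    show "range ?h0 \<inter> range ?h1 = {}" "range ?h0 \<inter> range ?h2 = {}" "range ?h1 \<inter> range ?h2 = {}"
      by (auto, presburger+)
    fix p assume p: "p \<notin> range ?h0" "p \<notin> range ?h1" "p \<notin> range ?h2"
    obtain k l where kl: "p = (k, l)" by (cases p)
    have "?e p mod int 6 \<noteq> int r"
    proof
      assume "?e p mod int 6 = int r"
      moreover have "(6 * z + 3 * l + 4) mod 6 = (3 * l + 4) mod 6" for z :: int by presburger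
      ultimately have m: "(3 * l + 4) mod 6 = int r" unfolding kl prod.case by (simp only: of_nat_numeral)
      have "l = 6 * (l div 6) + int t \<or> l = 6 * (l div 6) + 2 + int t \<or> l = - 2 - 6 * (- 1 - l div 6) + int t"
        using m assms by (elim disjE conjE) (simp, presburger)+
      then have "p = ?h0 (k, l div 6) \<or> p = ?h1 (k, l div 6) \<or> p = ?h2 (- 1 - k, - 1 - l div 6)"
        by (auto simp: kl)
      then show False using p by blast
    qed
    then show "?g p = 0" by (rule sect_fmon_eq_0) (use assms in auto)
  qed
  also have "(\<lambda>p. ?g (?h0 p)) = (\<lambda>p. fmon (case p of (k, l) \<Rightarrow> sn k * sg k l)
      ((case p of (k, l) \<Rightarrow> 3 * k * k + (3 + int t) * k + 6 * k * l + 3 * l + 0) + int t))"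
  proof
    fix p :: "int \<times> int"
    obtain k l where kl: "p = (k, l)" by (cases p)
    have w: "sg k (6 * l + int t) = sg k l" using t by (auto simp: sg_def)
    show "?g (?h0 p) = fmon (case p of (k, l) \<Rightarrow> sn k * sg k l)
      ((case p of (k, l) \<Rightarrow> 3 * k * k + (3 + int t) * k + 6 * k * l + 3 * l + 0) + int t)"
      unfolding kl prod.case w using assms by (intro sect_fmon) (auto simp: algebra_simps)
  qed
  also have "fsum \<dots> = fps_X ^ t * lerch (3 + int t) 3 0"
    unfolding lerch_def by (subst mon_sum_shift[symmetric], rule a) (use t in \<open>simp_all add: mon_sum_def\<close>)
  also have "(\<lambda>p. ?g (?h1 p)) = (\<lambda>p. fmon (case p of (k, l) \<Rightarrow> sn k * sg k l)
      ((case p of (k, l) \<Rightarrow> 3 * k * k + (5 + int t) * k + 6 * k * l + 3 * l + 0) + int (1 + t)))"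
  proof
    fix p :: "int \<times> int"
    obtain k l where kl: "p = (k, l)" by (cases p)
    have w: "sg k (6 * l + 2 + int t) = sg k l" using t by (auto simp: sg_def)
    show "?g (?h1 p) = fmon (case p of (k, l) \<Rightarrow> sn k * sg k l)
      ((case p of (k, l) \<Rightarrow> 3 * k * k + (5 + int t) * k + 6 * k * l + 3 * l + 0) + int (1 + t))"
      unfolding kl prod.case w using assms by (intro sect_fmon) (auto simp: algebra_simps)
  qed
  also have "fsum \<dots> = fps_X ^ (1 + t) * lerch (5 + int t) 3 0"
    unfolding lerch_def by (subst mon_sum_shift[symmetric], rule a) (use t in \<open>simp_all add: mon_sum_def\<close>)
  also have "(\<lambda>p. ?g (?h2 p)) = (\<lambda>p. fmon (case p of (k, l) \<Rightarrow> sn k * sg k l)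
      ((case p of (k, l) \<Rightarrow> 3 * k * k + (5 - int t) * k + 6 * k * l + 3 * l + 0) + int 1))"
  proof
    fix p :: "int \<times> int"
    obtain k l where kl: "p = (k, l)" by (cases p)
    have w: "sn (- 1 - k) * sg (- 1 - k) (- 2 - 6 * l + int t) = sn k * sg k l"
      using t by (auto simp: sn_def sg_def)
    show "?g (?h2 p) = fmon (case p of (k, l) \<Rightarrow> sn k * sg k l)
      ((case p of (k, l) \<Rightarrow> 3 * k * k + (5 - int t) * k + 6 * k * l + 3 * l + 0) + int 1)"
      unfolding kl prod.case w using assms by (intro sect_fmon) (auto simp: algebra_simps)
  qed
  also have "fsum \<dots> = fps_X ^ 1 * lerch (5 - int t) 3 0"
    unfolding lerch_def by (subst mon_sum_shift[symmetric], rule a) (use t in \<open>simp_all add: mon_sum_def\<close>)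
  finally show ?thesis by (simp add: case_prod_unfold)
qed

text \<open>For r > 0 the classes 0 and 2 of k modulo 3 contribute equal Lerch sums, hence the
  factors 2. For r = 0 the moved threshold makes the second one
  \<open>fps_X * L 7 1\<close>.\<close>

lemma sect_Lambert_values:
  "sect 6 0 Lambert = L 1 1 + fps_X * L 7 1"
  "sect 6 1 Lambert = 2 * L 2 1 - fps_X * (2 * L 4 3 + fps_X * L 6 3)"
  "sect 6 2 Lambert = 2 * L 3 1"
  "sect 6 3 Lambert = 2 * L 4 1"
  "sect 6 4 Lambert = 2 * L 5 1 - (L 3 3 + 2 * fps_X * L 5 3)"
  "sect 6 5 Lambert = 2 * L 6 1"
proof -
  have "fsum (\<lambda>(k, l). fmon (sn k * (if (0::nat) = 0 then sg k (l - 1) else sg k l))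
        (3 * k * k + (1 + int 0) * k + 6 * k * l + 1 * l + 0)) = fps_X * L 7 1"
    using lerch_shift[of 1 1] by (simp add: mon_sum_def split_def)
  then show "sect 6 0 Lambert = L 1 1 + fps_X * L 7 1"
    using sect_Lambert[of 0] sect_Lambert_middle_eq_0[of 0] by simp
  have pos: "fsum (\<lambda>(k, l). fmon (sn k * (if r = 0 then sg k (l - 1) else sg k l))
        (3 * k * k + (1 + int r) * k + 6 * k * l + 1 * l + 0)) = lerch (1 + int r) 1 0" if "r \<noteq> 0" for r :: nat
    using that by (simp add: lerch_def mon_sum_def split_def)
  show "sect 6 2 Lambert = 2 * L 3 1" "sect 6 3 Lambert = 2 * L 4 1" "sect 6 5 Lambert = 2 * L 6 1"
    using sect_Lambert[of 2] sect_Lambert[of 3] sect_Lambert[of 5] pos[of 2] pos[of 3] pos[of 5]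
      sect_Lambert_middle_eq_0[of 2] sect_Lambert_middle_eq_0[of 3] sect_Lambert_middle_eq_0[of 5]
    by simp_all
  show "sect 6 1 Lambert = 2 * L 2 1 - fps_X * (2 * L 4 3 + fps_X * L 6 3)"
    using sect_Lambert[of 1] pos[of 1] sect_Lambert_middle[of 1 1] by (simp add: algebra_simps)
  show "sect 6 4 Lambert = 2 * L 5 1 - (L 3 3 + 2 * fps_X * L 5 3)"
    using sect_Lambert[of 4] pos[of 4] sect_Lambert_middle[of 0 4] by (simp add: algebra_simps)
qed

section \<open>Divisibility\<close>

lemma theta_nth_0: assumes "0 \<le> r" "r < 3" shows "fps_nth (theta r 0) 0 = 1"
proof -
  have zero: "n = 0" if "3 * n * n + r * n + 0 = int 0" for n
  proof -
    from that have "n * (3 * n + r) = 0" by (simp add: algebra_simps)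
    then have "n = 0 \<or> 3 * n + r = 0" by simp
    then show ?thesis using assms by presburger
  qed
  have "fps_nth (theta r 0) 0 = (\<Sum>n\<in>{0}. fps_nth (fmon (sn n) (3 * n * n + r * n + 0)) 0)"
    unfolding theta_def mon_sum_def
  proof (rule fsum_nth_eq)
    fix n assume "fps_nth (fmon (sn n) (3 * n * n + r * n + 0)) 0 \<noteq> 0"
    then have "3 * n * n + r * n + 0 = int 0" unfolding fmon_nth by (rule contrapos_np) simp
    from zero[OF this] show "n \<in> {0}" by simp
  qed simp
  then show ?thesis by (simp add: fmon_nth sn_def)
qed

lemma L_nth_0: "fps_nth (L 3 1) 0 = 1"
proof -
  have zero: "k = 0 \<and> l = 0" if "sg k l \<noteq> 0" "3 * k * k + 3 * k + 6 * k * l + 1 * l + 0 = 0" for k l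
    using that(1) unfolding sg_nonzero
  proof
    assume kl: "0 \<le> k \<and> 0 \<le> l"
    then have "0 \<le> 3 * k * k" "0 \<le> 6 * k * l" by simp_all
    with that(2) kl show ?thesis by linarith
  next
    assume kl: "k < 0 \<and> l < 0"
    then have "0 \<le> (- 1 - k) * (- 1 - k)" "0 \<le> (- 1 - k) * (- 1 - l)" by simp_all
    with that(2) kl show ?thesis by (simp add: algebra_simps)
  qed
  have "fps_nth (L 3 1) 0 = (\<Sum>p\<in>{(0, 0)}. fps_nth (fmon (case p of (k, l) \<Rightarrow> sn k * sg k l)
      (case p of (k, l) \<Rightarrow> 3 * k * k + 3 * k + 6 * k * l + 1 * l + 0)) 0)"
    unfolding lerch_def mon_sum_def
  proof (rule fsum_nth_eq)
    fix p assume p: "fps_nth (fmon (case p of (k, l) \<Rightarrow> sn k * sg k l)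
      (case p of (k, l) \<Rightarrow> 3 * k * k + 3 * k + 6 * k * l + 1 * l + 0)) 0 \<noteq> 0"
    obtain k l where kl: "p = (k, l)" by (cases p)
    have "sg k l \<noteq> 0" using p unfolding kl fmon_nth by (rule contrapos_nn) simp
    moreover have "3 * k * k + 3 * k + 6 * k * l + 1 * l + 0 = 0"
      using p unfolding kl fmon_nth by (rule contrapos_np) simp
    ultimately show "p \<in> {(0, 0)}" using zero[of k l] by (simp add: kl)
  qed simp
  then show ?thesis by (simp add: fmon_nth sn_def sg_def)
qed

lemma nonzero: "\<theta>\<^sub>0 \<noteq> 0" "\<theta>\<^sub>1 \<noteq> 0" "\<theta>\<^sub>2 \<noteq> 0" "L 3 1 \<noteq> 0"
  using theta_nth_0[of 0] theta_nth_0[of 1] theta_nth_0[of 2] L_nth_0 by auto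

text \<open>Multiplied by theta_0, both sides become theta_1 theta_2 \<open>kronecker 1 2\<close>.
  The point is the right side, whose exponents are all even.\<close>

lemma kappa: "\<theta>\<^sub>2 * L 3 1 = \<theta>\<^sub>1 * L 3 2"
proof -
  have "\<theta>\<^sub>0 * (\<theta>\<^sub>2 * L 3 1) = \<theta>\<^sub>0 * (\<theta>\<^sub>1 * L 3 2)"
    using kronecker_values(3,4) by algebra
  then show ?thesis using nonzero by simp
qed

text \<open>The combination theta_1 (1) = theta_0 (4) + X theta_2 (5) of the numbered
  \<open>lerch_relations\<close> eliminates \<open>L 4 1\<close>, \<open>L 5 2\<close> and
  \<open>L 6 3\<close>. The Kronecker sums that remain are multiples of \<open>L 3 1\<close> and
  \<open>L 3 2\<close>; \<open>kappa\<close> removes the latter, and \<open>L 3 1\<close> is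
  cancelled.\<close>

lemma theta_quartic: "\<theta>\<^sub>1 ^ 4 = \<theta>\<^sub>2 * (\<theta>\<^sub>0 ^ 3 + fps_X * \<theta>\<^sub>2 ^ 3)"
proof -
  have "\<theta>\<^sub>1 ^ 2 * kronecker 1 3 = \<theta>\<^sub>0 ^ 2 * kronecker 1 4 + fps_X * \<theta>\<^sub>2 ^ 2 * kronecker 2 3"
    using lerch_relations(1,4,5) by algebra
  then have "\<theta>\<^sub>1 ^ 3 * (\<theta>\<^sub>0 * kronecker 1 3)
      = \<theta>\<^sub>0 ^ 3 * (\<theta>\<^sub>1 * kronecker 1 4) + fps_X * \<theta>\<^sub>2 ^ 2 * \<theta>\<^sub>1 * (\<theta>\<^sub>0 * kronecker 2 3)"
    by algebra
  then have "\<theta>\<^sub>1 ^ 3 * (\<theta>\<^sub>1 * L 3 1) = \<theta>\<^sub>0 ^ 3 * (\<theta>\<^sub>2 * L 3 1) + fps_X * \<theta>\<^sub>2 ^ 3 * (\<theta>\<^sub>1 * L 3 2)"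
    unfolding kronecker_values(1,5,6)[symmetric] by algebra
  then have "L 3 1 * \<theta>\<^sub>1 ^ 4 = L 3 1 * (\<theta>\<^sub>2 * (\<theta>\<^sub>0 ^ 3 + fps_X * \<theta>\<^sub>2 ^ 3))"
    unfolding kappa[symmetric] by algebra
  then show ?thesis using nonzero(4) by simp
qed

lemma cub_b3: "cub * sect 6 3 (Abs_fps b) = 6 * \<theta>\<^sub>1 ^ 2 * L 3 1"
proof -
  \<comment> \<open>The coefficient 8 of X theta_2^2 \<open>L 6 1\<close> is divided evenly: one
    half completes the relation with \<open>L 2 1\<close>, the other half the vanishing relation
    with \<open>L 4 3\<close>.\<close>
  have "cub * sect 6 3 (Abs_fps b) = 2 * \<theta>\<^sub>0 * (\<theta>\<^sub>0 * L 4 1 - fps_X ^ 2 * (\<theta>\<^sub>2 * L 6 3))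
      + 4 * \<theta>\<^sub>2 * (\<theta>\<^sub>0 * L 2 1 + fps_X * (\<theta>\<^sub>2 * L 6 1))
      - 4 * fps_X * \<theta>\<^sub>2 * (\<theta>\<^sub>0 * L 4 3 - \<theta>\<^sub>2 * L 6 1)"
    unfolding cub_sect sect_Lambert_values by algebra
  also have "\<dots> = 2 * \<theta>\<^sub>1 * (\<theta>\<^sub>0 * kronecker 1 3) + 4 * \<theta>\<^sub>1 * (\<theta>\<^sub>2 * kronecker 1 1)"
    unfolding lerch_relations(1-3) by algebra
  also have "\<dots> = 6 * \<theta>\<^sub>1 ^ 2 * L 3 1"
    unfolding kronecker_values(1,2)[symmetric] by algebra
  finally show ?thesis .
qed

text \<open>Every part reduces to theta_0 kappa; the constant arises as 9 = 2 - 1 + 4 + 4.\<close>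

lemma cub_b4: "cub * sect 6 4 (Abs_fps b) = 9 * \<theta>\<^sub>0 * (\<theta>\<^sub>2 * L 3 1)"
proof -
  have "\<theta>\<^sub>1 * (\<theta>\<^sub>0 * (L 5 1 - fps_X * L 5 3)) = \<theta>\<^sub>1 * (\<theta>\<^sub>2 * L 3 1)"
    using lerch_relations(7) kronecker_values(1) by algebra
  then have 1: "\<theta>\<^sub>0 * (L 5 1 - fps_X * L 5 3) = \<theta>\<^sub>2 * L 3 1" using nonzero by simp
  have "\<theta>\<^sub>1 * (\<theta>\<^sub>0 * L 3 3) = \<theta>\<^sub>1 * (\<theta>\<^sub>2 * L 3 1)"
    using kronecker_values(1,7) by algebra
  then have 2: "\<theta>\<^sub>0 * L 3 3 = \<theta>\<^sub>2 * L 3 1" using nonzero by simp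
  have "\<theta>\<^sub>1 * (\<theta>\<^sub>2 * (L 1 1 + fps_X * L 7 1)) = \<theta>\<^sub>1 * (\<theta>\<^sub>0 * L 3 1)"
    using lerch_relations(6) kronecker_values(2) by algebra
  then have 3: "\<theta>\<^sub>2 * (L 1 1 + fps_X * L 7 1) = \<theta>\<^sub>0 * L 3 1" using nonzero by simp
  have "cub * sect 6 4 (Abs_fps b) = 2 * \<theta>\<^sub>0 * (\<theta>\<^sub>0 * (L 5 1 - fps_X * L 5 3)) - \<theta>\<^sub>0 * (\<theta>\<^sub>0 * L 3 3)
      + 4 * \<theta>\<^sub>0 * \<theta>\<^sub>2 * L 3 1 + 4 * \<theta>\<^sub>2 * (\<theta>\<^sub>2 * (L 1 1 + fps_X * L 7 1))"
    unfolding cub_sect sect_Lambert_values by algebra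
  then show ?thesis unfolding 1 2 3 by algebra
qed

section \<open>Integral series and even series\<close>

definition int_fps :: "rat fps \<Rightarrow> bool" where "int_fps f \<longleftrightarrow> (\<forall>n. fps_nth f n \<in> \<int>)"

definition even_fps :: "rat fps \<Rightarrow> bool" where "even_fps f \<longleftrightarrow> (\<forall>n. odd n \<longrightarrow> fps_nth f n = 0)"

lemma int_fps_mult: "int_fps f \<Longrightarrow> int_fps g \<Longrightarrow> int_fps (f * g)"
  by (auto simp: int_fps_def fps_mult_nth intro!: Ints_mult)

lemma int_fps_add: "int_fps f \<Longrightarrow> int_fps g \<Longrightarrow> int_fps (f + g)"
  by (simp add: int_fps_def)

lemma int_fps_diff: "int_fps f \<Longrightarrow> int_fps g \<Longrightarrow> int_fps (f - g)"
  by (simp add: int_fps_def)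

lemma int_fps_numeral: "int_fps (numeral k)"
  by (simp add: int_fps_def numeral_fps_const)

lemma int_fps_1: "int_fps 1"
  by (simp add: int_fps_def)

lemma int_fps_power: "int_fps f \<Longrightarrow> int_fps (f ^ n)"
  by (induction n) (simp_all add: int_fps_1 int_fps_mult)

lemma int_fps_X: "int_fps fps_X"
  by (simp add: int_fps_def fps_X_nth)

lemma int_fps_fsum: "(\<And>i. int_fps (g i)) \<Longrightarrow> int_fps (fsum g)"
  by (auto simp: int_fps_def fsum_nth)

lemma int_fps_theta: "int_fps (theta r s)"
  unfolding theta_def mon_sum_def by (rule int_fps_fsum) (simp add: int_fps_def fmon_nth sn_def)

lemma int_fps_lerch: "int_fps (lerch r \<alpha> s)"
  unfolding lerch_def mon_sum_def
  by (rule int_fps_fsum) (auto simp: int_fps_def fmon_nth sn_def sg_def)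

lemmas int_fps_intros = int_fps_mult int_fps_add int_fps_diff int_fps_numeral int_fps_1
  int_fps_power int_fps_X int_fps_theta int_fps_lerch

lemma fps_mult_nth_lead:
  assumes "fps_nth f 0 = (1 :: 'a::comm_ring_1)"
  shows "fps_nth g n = fps_nth (f * g) n - (\<Sum>i = Suc 0..n. fps_nth f i * fps_nth g (n - i))"
  using assms by (simp add: fps_mult_nth sum.atLeast_Suc_atMost)

text \<open>With constant coefficient 1 in f, each coefficient of g is obtained from lower ones and
  a coefficient of the product without any division.\<close>

lemma int_fps_cancel:
  assumes "int_fps f" "fps_nth f 0 = 1" "int_fps (f * g)" shows "int_fps g"
  unfolding int_fps_def
proof
  fix n show "fps_nth g n \<in> \<int>"
  proof (induction n rule: less_induct)
    case (less n)
    have "(\<Sum>i = Suc 0..n. fps_nth f i * fps_nth g (n - i)) \<in> \<int>"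
      using assms(1) less by (intro Ints_sum Ints_mult) (auto simp: int_fps_def)
    then show ?case
      using assms(3) by (subst fps_mult_nth_lead[OF assms(2)]) (auto simp: int_fps_def)
  qed
qed

lemma even_fps_mult:
  assumes "even_fps f" "even_fps g" shows "even_fps (f * g)"
  unfolding even_fps_def fps_mult_nth
proof (intro allI impI sum.neutral ballI)
  fix n i :: nat assume "odd n" "i \<in> {0..n}"
  then have "odd i \<or> odd (n - i)" by auto
  then have "fps_nth f i = 0 \<or> fps_nth g (n - i) = 0"
    using assms unfolding even_fps_def by blast
  then show "fps_nth f i * fps_nth g (n - i) = 0" by auto
qed

lemma even_fps_cancel:
  assumes "even_fps f" "fps_nth f 0 = 1" "even_fps (f * g)" shows "even_fps g"
  unfolding even_fps_def
proof
  fix n show "odd n \<longrightarrow> fps_nth g n = 0"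
  proof (induction n rule: less_induct)
    case (less n)
    show ?case
    proof
      assume n: "odd n"
      have "(\<Sum>i = Suc 0..n. fps_nth f i * fps_nth g (n - i)) = 0"
      proof (rule sum.neutral, rule ballI)
        fix i assume i: "i \<in> {Suc 0..n}"
        with n have "odd i \<or> odd (n - i)" by auto
        then show "fps_nth f i * fps_nth g (n - i) = 0"
          using assms(1) less[of "n - i"] i by (auto simp: even_fps_def)
      qed
      then show "fps_nth g n = 0"
        using assms(3) n by (subst fps_mult_nth_lead[OF assms(2)]) (simp add: even_fps_def)
    qed
  qed
qed

lemma even_fps_fsum: "(\<And>i. even_fps (g i)) \<Longrightarrow> even_fps (fsum g)"
  by (auto simp: even_fps_def fsum_nth)

lemma even_fps_fmon: "even e \<Longrightarrow> even_fps (fmon c e)"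
  by (auto simp: even_fps_def fmon_nth)

text \<open>Visible only in the form theta_1 \<open>L 3 2\<close>: the exponents 3n^2 + n and 3k^2 +
  3k + 6kl + 2l are always even.\<close>

lemma even_kappa: "even_fps (\<theta>\<^sub>2 * L 3 1)"
proof -
  have "even (3 * n * n + 1 * n + 0)" for n :: int by simp
  then have "even_fps \<theta>\<^sub>1" unfolding theta_def mon_sum_def by (intro even_fps_fsum even_fps_fmon)
  moreover have "even (3 * k * k + 3 * k + 6 * k * l + 2 * l + 0)" for k l :: int by simp
  then have "even_fps (L 3 2)"
    unfolding lerch_def mon_sum_def by (intro even_fps_fsum even_fps_fmon) (simp add: split_def)
  ultimately show ?thesis unfolding kappa by (rule even_fps_mult)
qed

lemma even_theta1: "even_fps \<theta>\<^sub>1"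
  unfolding theta_def mon_sum_def by (intro even_fps_fsum even_fps_fmon) simp

lemma cub_nth_0: "fps_nth cub 0 = 1"
  using theta_nth_0[of 0] by (simp add: cub_def power3_eq_cube numeral_fps_const)

lemma int_cub: "int_fps cub"
  unfolding cub_def by (intro int_fps_intros)

text \<open>The terms for n and -n coincide. Consequently theta_0^2 = 1 + 4 (t + t^2).\<close>

lemma theta0_decomp: obtains t where "int_fps t" "\<theta>\<^sub>0 = 1 + 2 * t"
proof
  let ?t = "fsum (\<lambda>m. fps_X ^ (3 * (Suc m * Suc m)) * (- 1) ^ Suc m) :: rat fps"
  have "int_fps (- 1)" by (simp add: int_fps_def)
  then show "int_fps ?t" by (intro int_fps_fsum int_fps_intros)
  show "\<theta>\<^sub>0 = 1 + 2 * ?t" using mon_sum_square[of 3] by (simp add: theta_def)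
qed

lemma mult_inverse_cancel:
  fixes f g :: "'a::field fps" assumes "fps_nth f 0 = 1" shows "f * (inverse f * g) = g"
  using assms by (simp add: inverse_mult_eq_1' flip: mult.assoc)

lemma cub_divide:
  assumes "int_fps x" "cub * f = c * x"
  obtains g where "int_fps g" "f = c * g" "cub * g = x"
proof
  let ?g = "inverse cub * x"
  show c: "cub * ?g = x"
    by (rule mult_inverse_cancel[OF cub_nth_0])
  show "int_fps ?g"
    by (rule int_fps_cancel[OF int_cub cub_nth_0]) (unfold c, rule assms(1))
  have "cub * f = cub * (c * ?g)"
    by (simp only: assms(2) mult.left_commute[of cub c] c)
  then show "f = c * ?g" using cub_nth_0 by auto
qed

text \<open>Multiplying the hypothesis by theta_2 and using the quartic identity gives (theta_1^4 -
  9 X theta_2^4) g = theta_1^2 kappa. Division by theta_1^2 leaves theta_1^2 (g - 9 r) = kappa,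
  where theta_1^2 and kappa are even.\<close>

lemma b3_odd:
  assumes "int_fps g" "cub * g = \<theta>\<^sub>1 ^ 2 * L 3 1"
  obtains r where "int_fps r" "even_fps (g - 9 * r)"
proof -
  \<comment> \<open>\<open>h\<close> and \<open>r\<close> are the series X theta_2^4 g divided by
    theta_1^2 once and twice; they stay integral because theta_1^2 has constant coefficient
    1.\<close>
  define h where "h = inverse (\<theta>\<^sub>1 ^ 2) * (fps_X * \<theta>\<^sub>2 ^ 4 * g)"
  define r where "r = inverse (\<theta>\<^sub>1 ^ 2) * h"
  have n1: "fps_nth (\<theta>\<^sub>1 ^ 2) 0 = 1" using theta_nth_0[of 1] by (simp add: power2_eq_square)
  have h: "\<theta>\<^sub>1 ^ 2 * h = fps_X * \<theta>\<^sub>2 ^ 4 * g"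
    unfolding h_def by (rule mult_inverse_cancel[OF n1])
  have r: "\<theta>\<^sub>1 ^ 2 * r = h"
    unfolding r_def by (rule mult_inverse_cancel[OF n1])
  have "int_fps (\<theta>\<^sub>1 ^ 2 * h)" unfolding h by (intro int_fps_intros assms(1))
  then have "int_fps h" by (rule int_fps_cancel[OF int_fps_power[OF int_fps_theta] n1])
  then have "int_fps r"
    unfolding r[symmetric] by (rule int_fps_cancel[OF int_fps_power[OF int_fps_theta] n1])
  moreover have "even_fps (g - 9 * r)"
  proof (rule even_fps_cancel[OF _ n1])
    show "even_fps (\<theta>\<^sub>1 ^ 2)" unfolding power2_eq_square by (intro even_fps_mult even_theta1)
    have "\<theta>\<^sub>1 ^ 2 * (\<theta>\<^sub>1 ^ 2 * (g - 9 * r)) = \<theta>\<^sub>1 ^ 2 * (\<theta>\<^sub>2 * L 3 1)"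
      using theta_quartic assms(2) h r unfolding cub_def by algebra
    then have "\<theta>\<^sub>1 ^ 2 * (g - 9 * r) = \<theta>\<^sub>2 * L 3 1"
      by (rule mult_left_cancel[THEN iffD1, rotated]) (use nonzero in simp)
    then show "even_fps (\<theta>\<^sub>1 ^ 2 * (g - 9 * r))" using even_kappa by simp
  qed
  ultimately show ?thesis by (rule that)
qed

text \<open>Cancelling theta_0 in the hypothesis gives theta_0^2 g = kappa + 8 h with h integral,
  and theta_0^2 is 1 modulo 4; so g agrees with kappa modulo 4.\<close>

lemma b4_odd:
  assumes "int_fps g" "cub * g = \<theta>\<^sub>0 * (\<theta>\<^sub>2 * L 3 1)"
  obtains r where "int_fps r" "even_fps (g - 4 * r)"
proof -
  obtain t where t: "int_fps t" "\<theta>\<^sub>0 = 1 + 2 * t" by (rule theta0_decomp)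
  define h where "h = inverse \<theta>\<^sub>0 * (fps_X * \<theta>\<^sub>2 ^ 3 * g)"
  have n0: "fps_nth \<theta>\<^sub>0 0 = 1" using theta_nth_0[of 0] by simp
  have h: "\<theta>\<^sub>0 * h = fps_X * \<theta>\<^sub>2 ^ 3 * g"
    unfolding h_def by (rule mult_inverse_cancel[OF n0])
  have "int_fps (\<theta>\<^sub>0 * h)" unfolding h by (intro int_fps_intros assms(1))
  then have "int_fps h" by (rule int_fps_cancel[OF int_fps_theta n0])
  \<comment> \<open>The witness is read off from g (1 + 4 (t + t^2)) = kappa + 8 h, solved for (g -
    kappa) / 4.\<close>
  then have "int_fps (2 * h - g * (t + t * t))"
    by (intro int_fps_intros assms(1) t(1))
  moreover have "g - 4 * (2 * h - g * (t + t * t)) = \<theta>\<^sub>2 * L 3 1"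
  proof -
    have "\<theta>\<^sub>0 * (g * \<theta>\<^sub>0 ^ 2) = \<theta>\<^sub>0 * (\<theta>\<^sub>2 * L 3 1 + 8 * h)"
      using assms(2) h unfolding cub_def by algebra
    then have "g * \<theta>\<^sub>0 ^ 2 = \<theta>\<^sub>2 * L 3 1 + 8 * h" using nonzero by simp
    then show ?thesis using t(2) by algebra
  qed
  ultimately show ?thesis using that even_kappa by metis
qed

lemma int_fpsE:
  assumes "int_fps f" obtains k :: int where "fps_nth f n = of_int k"
  using assms by (auto simp: int_fps_def elim: Ints_cases)

theorem theorem1p3:
  fixes n :: nat
  shows "(\<exists>k::int. b (6*n+3) = of_int (6*k))
       \<and> (\<exists>k::int. b (36*n+22) = of_int (36*k))
       \<and> (\<exists>k::int. b (12*n+9) = of_int (54*k))"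
proof (intro conjI)
  obtain g where g: "int_fps g" "sect 6 3 (Abs_fps b) = 6 * g" "cub * g = \<theta>\<^sub>1 ^ 2 * L 3 1"
    by (rule cub_divide[of "\<theta>\<^sub>1 ^ 2 * L 3 1" "sect 6 3 (Abs_fps b)" 6])
      (simp_all only: int_fps_intros cub_b3 mult.assoc)
  obtain r where r: "int_fps r" "even_fps (g - 9 * r)" by (rule b3_odd[OF g(1,3)])
  have b3: "b (6 * m + 3) = 6 * fps_nth g m" for m
    using arg_cong[OF g(2), of "\<lambda>f. fps_nth f m"] by (simp add: sect_nth numeral_fps_const)
  show "\<exists>k::int. b (6*n+3) = of_int (6*k)"
  proof -
    obtain k where "fps_nth g n = of_int k" by (rule int_fpsE[OF g(1)])
    then have "b (6*n+3) = of_int (6*k)" by (simp add: b3)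
    then show ?thesis ..
  qed
  \<comment> \<open>Since 12n + 9 = 6 (2n + 1) + 3, the progression picks out the odd coefficients
    of g, and 54 = 6 * 9.\<close>
  have "fps_nth g (2 * n + 1) = 9 * fps_nth r (2 * n + 1)"
    using r(2) by (simp add: even_fps_def numeral_fps_const)
  then have b3_odd: "b (12*n+9) = 54 * fps_nth r (2 * n + 1)"
    using b3[of "2 * n + 1"] by (simp add: add.commute)
  obtain k where "fps_nth r (2 * n + 1) = of_int k" by (rule int_fpsE[OF r(1)])
  then have "b (12*n+9) = of_int (54*k)" by (simp add: b3_odd)
  then show "\<exists>k::int. b (12*n+9) = of_int (54*k)" ..
next
  obtain g where g: "int_fps g" "sect 6 4 (Abs_fps b) = 9 * g" "cub * g = \<theta>\<^sub>0 * (\<theta>\<^sub>2 * L 3 1)"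
    by (rule cub_divide[of "\<theta>\<^sub>0 * (\<theta>\<^sub>2 * L 3 1)" "sect 6 4 (Abs_fps b)" 9])
      (simp_all only: int_fps_intros cub_b4 mult.assoc)
  obtain r where r: "int_fps r" "even_fps (g - 4 * r)" by (rule b4_odd[OF g(1,3)])
  \<comment> \<open>Since 36n + 22 = 6 (6n + 3) + 4 and 6n + 3 is odd, the even series contributes
    nothing here, and 36 = 9 * 4.\<close>
  have "fps_nth g (6 * n + 3) = 4 * fps_nth r (6 * n + 3)"
    using r(2) by (simp add: even_fps_def numeral_fps_const)
  moreover have "b (6 * (6 * n + 3) + 4) = 9 * fps_nth g (6 * n + 3)"
    using arg_cong[OF g(2), of "\<lambda>f. fps_nth f (6 * n + 3)"] by (simp add: sect_nth numeral_fps_const)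
  ultimately have b4: "b (36*n+22) = 36 * fps_nth r (6 * n + 3)" by (simp add: add.commute)
  obtain k where "fps_nth r (6 * n + 3) = of_int k" by (rule int_fpsE[OF r(1)])
  then have "b (36*n+22) = of_int (36*k)" by (simp add: b4)
  then show "\<exists>k::int. b (36*n+22) = of_int (36*k)" ..
qed

end
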